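(* Let $\varphi$ be a quantifier-free formula of the language $\mathcal{L}$, and let $n$ be the number of variables of $\varphi$. The following are equivalent: (1) $\varphi$ is a theorem of $L$; (2) $\varphi$ is true in all topological contact algebras; (3) $\varphi$ is true in all DCJS; (4) $\varphi$ is true in all CJS; (5) $\varphi$ is true in all finite CJS having at most $2^n+1$ elements.
   Context: $\mathcal{L}$ is the quantifier-free first-order language (with equality) with constants $0,1$, a binary function symbol $+$ and binary predicate symbols $\leq$, $C$. "$\varphi$ is true in a structure" means true under every valuation of its variables. $L$ is the quantifier-free logic whose axioms are the axioms of CJS listed below (as quantifier-free formulas) and whose only rule of inference is modus ponens. A CJS is an $\mathcal{L}$-structure $(B,\leq,0,1,+,C)$ satisfying for all elements: (1) $x\leq x$; (2) $x\leq y\wedge y\leq x\rightarrow x=y$; (3) $x\leq y\wedge y\leq z\rightarrow x\leq z$; (4) $x+y=y+x$; (5) $x\leq x+y$; (6) $x\leq z\wedge y\leq z\rightarrow x+y\leq z$; (7) $0\leq x$; (8) $x\leq 1$; (9) $xCy\rightarrow x\neq 0$; (10) $xCy\rightarrow yCx$; and for all integers $m,i,n\geq1$: $A^1_{m,i}$: if $xCy$, and $x\leq s_j^1+\dots+s_j^i$ and $y\leq t_j^1+\dots+t_j^i$ for every $j=1,\dots,m$, then there are $l_1,\dots,l_m,k_1,\dots,k_m\in\{1,\dots,i\}$ with $s_j^{l_j}Cs_u^{l_u}$ and $t_j^{k_j}Ct_u^{k_u}$ for all $1\leq j\leq u\leq m$, and $s_j^{l_j}Ct_u^{k_u}$ for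 all $j,u$ (a finite disjunction of conjunctions); $A_{n,i}$: if $t\not\leq u$ and $t\leq x_k^1+\dots+x_k^i$ for every $k=1,\dots,n$, then there are $j_1,\dots,j_n\in\{1,\dots,i\}$ with $x_k^{j_k}\not\leq u$ for all $k$ and $x_k^{j_k}Cx_l^{j_l}$ for all $k,l$. A DCJS is an $\mathcal{L}$-structure satisfying (1)–(10) and (11) $xC(y+z)\rightarrow xCy\vee xCz$; (12) $xCy\wedge y\leq y'\rightarrow xCy'$; (13) $x\neq0\rightarrow xCx$; (ad) $x\leq a+b\rightarrow$ there are $a'\leq a$, $b'\leq b$ with $x=a'+b'$. The topological contact algebra over a topological space $X$ is the $\mathcal{L}$-structure $(RC(X),\subseteq,\emptyset,X,\cup,C)$, where $RC(X)$ is the set of regular closed subsets of $X$ (sets equal to the closure of their interior) and $aCb$ iff $a\cap b\neq\emptyset$. *)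

theory Defs
  imports "HOL-Analysis.Abstract_Topology"
begin

section \<open>Quantifier-free formulas\<close>

datatype trm =
    Var nat
  | Zero ("\<^bold>0")
  | One ("\<^bold>1")
  | Plus trm trm (infixl "\<^bold>+" 95)

datatype atm =
    Equal trm trm
  | Leq trm trm
  | Cont trm trm

datatype fm =
    Atom atm
  | Fls
  | Neg fm ("\<^bold>\<not> _" [85] 85)
  | Conj fm fm (infixr "\<^bold>\<and>" 75)
  | Disj fm fm (infixr "\<^bold>\<or>" 70)
  | Imp fm fm (infixr "\<^bold>\<longrightarrow>" 65)

abbreviation EqF :: "trm \<Rightarrow> trm \<Rightarrow> fm" (infix "\<^bold>=" 90)
  where "s \<^bold>= t \<equiv> Atom (Equal s t)"
abbreviation LeqF :: "trm \<Rightarrow> trm \<Rightarrow> fm" (infix "\<^bold>\<le>" 90)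
  where "s \<^bold>\<le> t \<equiv> Atom (Leq s t)"
abbreviation ContF :: "trm \<Rightarrow> trm \<Rightarrow> fm" (infix "\<^bold>C" 90)
  where "s \<^bold>C t \<equiv> Atom (Cont s t)"

primrec vars_trm :: "trm \<Rightarrow> nat set" where
  "vars_trm (Var x) = {x}"
| "vars_trm \<^bold>0 = {}"
| "vars_trm \<^bold>1 = {}"
| "vars_trm (s \<^bold>+ t) = vars_trm s \<union> vars_trm t"

primrec vars_atm :: "atm \<Rightarrow> nat set" where
  "vars_atm (Equal s t) = vars_trm s \<union> vars_trm t"
| "vars_atm (Leq s t) = vars_trm s \<union> vars_trm t"
| "vars_atm (Cont s t) = vars_trm s \<union> vars_trm t"

primrec vars :: "fm \<Rightarrow> nat set" where
  "vars (Atom a) = vars_atm a"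
| "vars Fls = {}"
| "vars (\<^bold>\<not> \<phi>) = vars \<phi>"
| "vars (\<phi> \<^bold>\<and> \<psi>) = vars \<phi> \<union> vars \<psi>"
| "vars (\<phi> \<^bold>\<or> \<psi>) = vars \<phi> \<union> vars \<psi>"
| "vars (\<phi> \<^bold>\<longrightarrow> \<psi>) = vars \<phi> \<union> vars \<psi>"

definition Conjs :: "fm list \<Rightarrow> fm" where
  "Conjs \<phi>s = foldr Conj \<phi>s (\<^bold>\<not> Fls)"

definition Disjs :: "fm list \<Rightarrow> fm" where
  "Disjs \<phi>s = foldr Disj \<phi>s Fls"


section \<open>Structures and truth\<close>

record 'a struct =
  carrier :: "'a set"
  le :: "'a \<Rightarrow> 'a \<Rightarrow> bool" (infix "\<preceq>\<index>" 50)
  zero :: 'a ("\<zero>\<index>")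
  one :: 'a ("\<one>\<index>")
  plus :: "'a \<Rightarrow> 'a \<Rightarrow> 'a" (infixl "\<oplus>\<index>" 65)
  contact :: "'a \<Rightarrow> 'a \<Rightarrow> bool" (infix "\<bowtie>\<index>" 50)

locale L_structure =
  fixes S :: "'a struct" (structure)
  assumes zero_closed: "\<zero> \<in> carrier S"
    and one_closed: "\<one> \<in> carrier S"
    and plus_closed:  "\<lbrakk>x \<in> carrier S; y \<in> carrier S\<rbrakk> \<Longrightarrow> x \<oplus> y \<in> carrier S"

primrec eval_trm :: "'a struct \<Rightarrow> (nat \<Rightarrow> 'a) \<Rightarrow> trm \<Rightarrow> 'a" where
  "eval_trm S v (Var x) = v x"
| "eval_trm S v \<^bold>0 = \<zero>\<^bsub>S\<^esub>"
| "eval_trm S v \<^bold>1 = \<one>\<^bsub>S\<^esub>"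
| "eval_trm S v (s \<^bold>+ t) = eval_trm S v s \<oplus>\<^bsub>S\<^esub> eval_trm S v t"

primrec eval_atm :: "'a struct \<Rightarrow> (nat \<Rightarrow> 'a) \<Rightarrow> atm \<Rightarrow> bool" where
  "eval_atm S v (Equal s t) \<longleftrightarrow> eval_trm S v s = eval_trm S v t"
| "eval_atm S v (Leq s t) \<longleftrightarrow> eval_trm S v s \<preceq>\<^bsub>S\<^esub> eval_trm S v t"
| "eval_atm S v (Cont s t) \<longleftrightarrow> eval_trm S v s \<bowtie>\<^bsub>S\<^esub> eval_trm S v t"

primrec eval_prop :: "(atm \<Rightarrow> bool) \<Rightarrow> fm \<Rightarrow> bool" where
  "eval_prop I (Atom a) \<longleftrightarrow> I a"
| "eval_prop I Fls \<longleftrightarrow> False"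
| "eval_prop I (\<^bold>\<not> \<phi>) \<longleftrightarrow> \<not> eval_prop I \<phi>"
| "eval_prop I (\<phi> \<^bold>\<and> \<psi>) \<longleftrightarrow> eval_prop I \<phi> \<and> eval_prop I \<psi>"
| "eval_prop I (\<phi> \<^bold>\<or> \<psi>) \<longleftrightarrow> eval_prop I \<phi> \<or> eval_prop I \<psi>"
| "eval_prop I (\<phi> \<^bold>\<longrightarrow> \<psi>) \<longleftrightarrow> (eval_prop I \<phi> \<longrightarrow> eval_prop I \<psi>)"

definition true_in :: "'a struct \<Rightarrow> fm \<Rightarrow> bool" (infix "\<Turnstile>" 50) where
  "S \<Turnstile> \<phi> \<longleftrightarrow> (\<forall>v. range v \<subseteq> carrier S \<longrightarrow> eval_prop (eval_atm S v) \<phi>)"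

text \<open>A tautology is true under \<^emph>\<open>every\<close> assignment of truth values to its atomic formulas,
  including assignments that interpret equality arbitrarily.\<close>

definition tautology :: "fm \<Rightarrow> bool" where
  "tautology \<phi> \<longleftrightarrow> (\<forall>I. eval_prop I \<phi>)"


section \<open>CJS, DCJS and topological contact algebras\<close>

text \<open>\<open>sum_upto p f i\<close> is \<open>f 1 + ... + f i\<close> (for \<open>i \<ge> 1\<close>), bracketed to the left. It is used for
  elements of structures and for terms alike.\<close>

definition sum_upto :: "('b \<Rightarrow> 'b \<Rightarrow> 'b) \<Rightarrow> (nat \<Rightarrow> 'b) \<Rightarrow> nat \<Rightarrow> 'b" where
  "sum_upto p f i = foldl p (f 1) (map f [2..<Suc i])"

locale pre_CJS = L_structure +
  assumes le_refl: "x \<in> carrier S \<Longrightarrow> x \<preceq> x"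
    and le_antisym: "\<lbrakk>x \<in> carrier S; y \<in> carrier S; x \<preceq> y; y \<preceq> x\<rbrakk> \<Longrightarrow> x = y"
    and le_trans: "\<lbrakk>x \<in> carrier S; y \<in> carrier S; z \<in> carrier S; x \<preceq> y; y \<preceq> z\<rbrakk> \<Longrightarrow> x \<preceq> z"
    and plus_comm: "\<lbrakk>x \<in> carrier S; y \<in> carrier S\<rbrakk> \<Longrightarrow> x \<oplus> y = y \<oplus> x"
    and le_plus: "\<lbrakk>x \<in> carrier S; y \<in> carrier S\<rbrakk> \<Longrightarrow> x \<preceq> x \<oplus> y"
    and plus_least:
      "\<lbrakk>x \<in> carrier S; y \<in> carrier S; z \<in> carrier S; x \<preceq> z; y \<preceq> z\<rbrakk> \<Longrightarrow> x \<oplus> y \<preceq> z"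
    and zero_le: "x \<in> carrier S \<Longrightarrow> \<zero> \<preceq> x"
    and le_one: "x \<in> carrier S \<Longrightarrow> x \<preceq> \<one>"
    and contact_nonzero: "\<lbrakk>x \<in> carrier S; y \<in> carrier S; x \<bowtie> y\<rbrakk> \<Longrightarrow> x \<noteq> \<zero>"
    and contact_sym: "\<lbrakk>x \<in> carrier S; y \<in> carrier S; x \<bowtie> y\<rbrakk> \<Longrightarrow> y \<bowtie> x"

text \<open>In \<open>ax_A1\<close> and \<open>ax_A\<close>, \<open>s j a\<close>, \<open>t j a\<close> and \<open>x k a\<close> stand for $s_j^a$, $t_j^a$ and
  $x_k^a$.\<close>

locale CJS = pre_CJS +
  assumes ax_A1:
    "\<And>(m::nat) i x y s t.
      \<lbrakk>m \<ge> 1; i \<ge> 1; x \<in> carrier S; y \<in> carrier S;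
       \<forall>j\<in>{1..m}. \<forall>a\<in>{1..i}. s j a \<in> carrier S \<and> t j a \<in> carrier S;
       x \<bowtie> y;
       \<forall>j\<in>{1..m}. x \<preceq> sum_upto (\<oplus>) (s j) i \<and> y \<preceq> sum_upto (\<oplus>) (t j) i\<rbrakk>
      \<Longrightarrow> \<exists>l k. (\<forall>j\<in>{1..m}. l j \<in> {1..i} \<and> k j \<in> {1..i}) \<and>
            (\<forall>u\<in>{1..m}. \<forall>j\<in>{1..u}.
               s j (l j) \<bowtie> s u (l u) \<and> t j (k j) \<bowtie> t u (k u)) \<and>
            (\<forall>j\<in>{1..m}. \<forall>u\<in>{1..m}. s j (l j) \<bowtie> t u (k u))"
    and ax_A:
    "\<And>(n::nat) i t u x.
      \<lbrakk>n \<ge> 1; i \<ge> 1; t \<in> carrier S; u \<in> carrier S;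
       \<forall>k\<in>{1..n}. \<forall>a\<in>{1..i}. x k a \<in> carrier S;
       \<not> t \<preceq> u;
       \<forall>k\<in>{1..n}. t \<preceq> sum_upto (\<oplus>) (x k) i\<rbrakk>
      \<Longrightarrow> \<exists>j. (\<forall>k\<in>{1..n}. j k \<in> {1..i}) \<and>
            (\<forall>k\<in>{1..n}. \<not> x k (j k) \<preceq> u) \<and>
            (\<forall>k\<in>{1..n}. \<forall>l\<in>{1..n}. x k (j k) \<bowtie> x l (j l))"

locale DCJS = pre_CJS +
  assumes contact_plus:
      "\<lbrakk>x \<in> carrier S; y \<in> carrier S; z \<in> carrier S; x \<bowtie> y \<oplus> z\<rbrakk> \<Longrightarrow> x \<bowtie> y \<or> x \<bowtie> z"
    and contact_mono:
      "\<lbrakk>x \<in> carrier S; y \<in> carrier S; y' \<in> carrier S; x \<bowtie> y; y \<preceq> y'\<rbrakk> \<Longrightarrow> x \<bowtie> y'"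
    and contact_refl: "\<lbrakk>x \<in> carrier S; x \<noteq> \<zero>\<rbrakk> \<Longrightarrow> x \<bowtie> x"
    and distrib:
      "\<lbrakk>x \<in> carrier S; a \<in> carrier S; b \<in> carrier S; x \<preceq> a \<oplus> b\<rbrakk>
       \<Longrightarrow> \<exists>a'\<in>carrier S. \<exists>b'\<in>carrier S. a' \<preceq> a \<and> b' \<preceq> b \<and> x = a' \<oplus> b'"

definition regular_closed :: "'p topology \<Rightarrow> 'p set set" where
  "regular_closed X = {a. a \<subseteq> topspace X \<and> X closure_of (X interior_of a) = a}"

definition top_contact_algebra :: "'p topology \<Rightarrow> 'p set struct" where
  "top_contact_algebra X =
     \<lparr>carrier = regular_closed X, le = (\<subseteq>), zero = {}, one = topspace X,
      plus = (\<union>), contact = (\<lambda>a b. a \<inter> b \<noteq> {})\<rparr>"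


section \<open>The logic\<close>

text \<open>The choice functions \<open>{1..m} \<rightarrow> {1..i}\<close>, as a list of functions.\<close>

definition choices :: "nat \<Rightarrow> nat \<Rightarrow> (nat \<Rightarrow> nat) list" where
  "choices m i = map (\<lambda>as j. as ! (j - 1)) (List.n_lists m [1..<Suc i])"

definition A1_fm ::
    "nat \<Rightarrow> nat \<Rightarrow> trm \<Rightarrow> trm \<Rightarrow> (nat \<Rightarrow> nat \<Rightarrow> trm) \<Rightarrow> (nat \<Rightarrow> nat \<Rightarrow> trm) \<Rightarrow> fm" where
  "A1_fm m i x y s t =
     (x \<^bold>C y \<^bold>\<and>
      Conjs [x \<^bold>\<le> sum_upto (\<^bold>+) (s j) i \<^bold>\<and> y \<^bold>\<le> sum_upto (\<^bold>+) (t j) i. j \<leftarrow> [1..<Suc m]])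
     \<^bold>\<longrightarrow>
     Disjs [Conjs [s j (l j) \<^bold>C s u (l u) \<^bold>\<and> t j (k j) \<^bold>C t u (k u).
                     u \<leftarrow> [1..<Suc m], j \<leftarrow> [1..<Suc u]] \<^bold>\<and>
            Conjs [s j (l j) \<^bold>C t u (k u). j \<leftarrow> [1..<Suc m], u \<leftarrow> [1..<Suc m]].
              l \<leftarrow> choices m i, k \<leftarrow> choices m i]"

definition A_fm :: "nat \<Rightarrow> nat \<Rightarrow> trm \<Rightarrow> trm \<Rightarrow> (nat \<Rightarrow> nat \<Rightarrow> trm) \<Rightarrow> fm" where
  "A_fm n i t u x =
     (\<^bold>\<not> (t \<^bold>\<le> u) \<^bold>\<and> Conjs [t \<^bold>\<le> sum_upto (\<^bold>+) (x k) i. k \<leftarrow> [1..<Suc n]])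
     \<^bold>\<longrightarrow>
     Disjs [Conjs [\<^bold>\<not> (x k (j k) \<^bold>\<le> u). k \<leftarrow> [1..<Suc n]] \<^bold>\<and>
            Conjs [x k (j k) \<^bold>C x l (j l). k \<leftarrow> [1..<Suc n], l \<leftarrow> [1..<Suc n]].
              j \<leftarrow> choices n i]"

text \<open>Since there is no substitution rule, the axioms are schemes: the letters range over
  arbitrary terms.\<close>

inductive CJS_axiom :: "fm \<Rightarrow> bool" where
  le_refl: "CJS_axiom (x \<^bold>\<le> x)"
| le_antisym: "CJS_axiom (x \<^bold>\<le> y \<^bold>\<and> y \<^bold>\<le> x \<^bold>\<longrightarrow> x \<^bold>= y)"
| le_trans: "CJS_axiom (x \<^bold>\<le> y \<^bold>\<and> y \<^bold>\<le> z \<^bold>\<longrightarrow> x \<^bold>\<le> z)"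
| plus_comm: "CJS_axiom (x \<^bold>+ y \<^bold>= y \<^bold>+ x)"
| le_plus: "CJS_axiom (x \<^bold>\<le> x \<^bold>+ y)"
| plus_least: "CJS_axiom (x \<^bold>\<le> z \<^bold>\<and> y \<^bold>\<le> z \<^bold>\<longrightarrow> x \<^bold>+ y \<^bold>\<le> z)"
| zero_le: "CJS_axiom (\<^bold>0 \<^bold>\<le> x)"
| le_one: "CJS_axiom (x \<^bold>\<le> \<^bold>1)"
| contact_nonzero: "CJS_axiom (x \<^bold>C y \<^bold>\<longrightarrow> \<^bold>\<not> (x \<^bold>= \<^bold>0))"
| contact_sym: "CJS_axiom (x \<^bold>C y \<^bold>\<longrightarrow> y \<^bold>C x)"
| A1: "\<lbrakk>m \<ge> 1; i \<ge> 1\<rbrakk> \<Longrightarrow> CJS_axiom (A1_fm m i x y s t)"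
| A: "\<lbrakk>n \<ge> 1; i \<ge> 1\<rbrakk> \<Longrightarrow> CJS_axiom (A_fm n i t u x)"

inductive equality_axiom :: "fm \<Rightarrow> bool" where
  refl: "equality_axiom (x \<^bold>= x)"
| sym: "equality_axiom (x \<^bold>= y \<^bold>\<longrightarrow> y \<^bold>= x)"
| trans: "equality_axiom (x \<^bold>= y \<^bold>\<and> y \<^bold>= z \<^bold>\<longrightarrow> x \<^bold>= z)"
| plus_cong: "equality_axiom (x \<^bold>= x' \<^bold>\<and> y \<^bold>= y' \<^bold>\<longrightarrow> x \<^bold>+ y \<^bold>= x' \<^bold>+ y')"
| le_cong: "equality_axiom (x \<^bold>= x' \<^bold>\<and> y \<^bold>= y' \<^bold>\<and> x \<^bold>\<le> y \<^bold>\<longrightarrow> x' \<^bold>\<le> y')"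
| contact_cong: "equality_axiom (x \<^bold>= x' \<^bold>\<and> y \<^bold>= y' \<^bold>\<and> x \<^bold>C y \<^bold>\<longrightarrow> x' \<^bold>C y')"

inductive L_theorem :: "fm \<Rightarrow> bool" ("\<turnstile> _" [50] 50) where
  taut: "tautology \<phi> \<Longrightarrow> \<turnstile> \<phi>"
| equality: "equality_axiom \<phi> \<Longrightarrow> \<turnstile> \<phi>"
| CJS: "CJS_axiom \<phi> \<Longrightarrow> \<turnstile> \<phi>"
| MP: "\<lbrakk>\<turnstile> \<phi> \<^bold>\<longrightarrow> \<psi>; \<turnstile> \<phi>\<rbrakk> \<Longrightarrow> \<turnstile> \<psi>"

end

theory Submission
  imports Defs
begin

text \<open>A non-theorem fails in a truth assignment that satisfies all theorems. Dividing the terms over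
  the variables of the formula by provable-in-the-assignment equality gives a CJS: as \<open>+\<close> is a join
  and \<open>1\<close> the top, a term is determined by its set of variables unless it contains \<open>1\<close>, whence
  at most $2^n + 1$ elements.

  In a finite CJS every prime up-set has the form \<open>{x. \<not> x \<le> e}\<close>. Applying an instance of \<open>A\<close> or
  \<open>A\<^sup>1\<close> to all coverings at once yields a set that meets every covering and whose elements are
  pairwise in contact; the join \<open>e\<close> of its complement is then a point. These points are made
  isolated, and two of them that are in contact get a common limit point; the regular closed sets
  of this finite space contain a copy of the CJS.

  Conversely, additive decomposition lets one shrink an element below one summand of each of finitely
  many coverings, so every DCJS is a CJS; and topological contact algebras are DCJS.\<close>

section \<open>Sums and the schemes\<close>

lemma sum_upto_1 [simp]: "sum_upto p f (Suc 0) = f (Suc 0)"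
  by (simp add: sum_upto_def)

lemma sum_upto_Suc:
  assumes "i \<ge> 1"
  shows "sum_upto p f (Suc i) = p (sum_upto p f i) (f (Suc i))"
proof -
  have "[2..<Suc (Suc i)] = [2..<Suc i] @ [Suc i]"
    using assms by simp
  then show ?thesis
    unfolding sum_upto_def by simp
qed

text \<open>Closure and the homomorphism property go by one induction, since \<open>h\<close> is
  only assumed to respect \<open>p\<close> on \<open>A\<close>. With \<open>h\<close> the identity
  this yields closure under sums; evaluation of terms and the quotient map are the other
  uses.\<close>

lemma sum_upto_hom:
  assumes "i \<ge> 1" and "\<And>a. a \<in> {1..i} \<Longrightarrow> f a \<in> A"
    and "\<And>x y. \<lbrakk>x \<in> A; y \<in> A\<rbrakk> \<Longrightarrow> p x y \<in> A \<and> h (p x y) = q (h x) (h y)"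
  shows "sum_upto p f i \<in> A \<and> h (sum_upto p f i) = sum_upto q (\<lambda>a. h (f a)) i"
  using assms(1,2)
proof (induction i rule: nat_induct_at_least)
  case base
  then show ?case by simp
next
  case (Suc i)
  have "f (Suc i) \<in> A"
    using Suc.prems by simp
  moreover have "sum_upto p f i \<in> A \<and> h (sum_upto p f i) = sum_upto q (\<lambda>a. h (f a)) i"
    using Suc.IH Suc.prems by simp
  ultimately show ?case
    using Suc.hyps assms(3) by (simp add: sum_upto_Suc)
qed

lemma sum_upto_cong:
  assumes "i \<ge> 1" and "\<And>a. a \<in> {1..i} \<Longrightarrow> f a = g a"
  shows "sum_upto p f i = sum_upto p g i"
  using assms
  by (induction i rule: nat_induct_at_least) (simp_all add: sum_upto_Suc)

lemma eval_trm_sum_upto: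
  assumes "i \<ge> 1"
  shows "eval_trm S v (sum_upto (\<^bold>+) f i) = sum_upto (plus S) (\<lambda>a. eval_trm S v (f a)) i"
  using sum_upto_hom[of i f UNIV "(\<^bold>+)" "eval_trm S v" "plus S"] assms by simp

lemma eval_prop_Conjs [simp]: "eval_prop I (Conjs \<phi>s) \<longleftrightarrow> (\<forall>\<psi>\<in>set \<phi>s. eval_prop I \<psi>)"
  by (induction \<phi>s) (auto simp: Conjs_def)

lemma eval_prop_Disjs [simp]: "eval_prop I (Disjs \<phi>s) \<longleftrightarrow> (\<exists>\<psi>\<in>set \<phi>s. eval_prop I \<psi>)"
  by (induction \<phi>s) (auto simp: Disjs_def)

lemma choices_range:
  assumes "f \<in> set (choices m i)" "j \<in> {1..m}"
  shows "f j \<in> {1..i}"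
proof -
  obtain xs where f: "f = (\<lambda>j. xs ! (j - 1))" and "length xs = m" and sub: "set xs \<subseteq> {1..i}"
    using assms(1) unfolding choices_def
    by (force simp: set_n_lists atLeastLessThanSuc_atLeastAtMost simp del: upt_Suc)
  then have "xs ! (j - 1) \<in> set xs"
    using assms(2) by (intro nth_mem) auto
  then show ?thesis
    using f sub by auto
qed

text \<open>A listed function reads its values off a list, so outside \<open>{1..m}\<close> they
  have nothing to do with \<open>f\<close>; agreement can be asked on \<open>{1..m}\<close>
  only.\<close>

lemma choices_complete:
  assumes "\<And>j. j \<in> {1..m} \<Longrightarrow> f j \<in> {1..i}"
  obtains g where "g \<in> set (choices m i)" "\<And>j. j \<in> {1..m} \<Longrightarrow> g j = f j"
proof
  let ?xs = "map f [1..<Suc m]"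
  have "?xs \<in> set (List.n_lists m [1..<Suc i])"
    using assms by (fastforce simp: set_n_lists)
  then show "(\<lambda>j. ?xs ! (j - 1)) \<in> set (choices m i)"
    unfolding choices_def set_map by (rule imageI)
  show "?xs ! (j - 1) = f j" if "j \<in> {1..m}" for j
  proof -
    have "?xs ! (j - 1) = f ([1..<Suc m] ! (j - 1))"
      using that by (intro nth_map) auto
    also have "[1..<Suc m] ! (j - 1) = j"
      using that by (subst nth_upt) auto
    finally show ?thesis .
  qed
qed

text \<open>The disjunction over listed functions becomes an existential over all functions because
  the body, \<open>Q\<close> in the proof, looks only at values on \<open>{1..m}\<close>. The
  curried form matches the premises and the conclusion of \<open>ax_A1\<close>.\<close>

lemma eval_prop_A1_fm:
  "eval_prop I (A1_fm m i x y s t) \<longleftrightarrow>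
    (I (Cont x y) \<longrightarrow>
     (\<forall>j\<in>{1..m}. I (Leq x (sum_upto (\<^bold>+) (s j) i)) \<and> I (Leq y (sum_upto (\<^bold>+) (t j) i))) \<longrightarrow>
     (\<exists>l k. (\<forall>j\<in>{1..m}. l j \<in> {1..i} \<and> k j \<in> {1..i}) \<and>
        (\<forall>u\<in>{1..m}. \<forall>j\<in>{1..u}. I (Cont (s j (l j)) (s u (l u))) \<and> I (Cont (t j (k j)) (t u (k u)))) \<and>
        (\<forall>j\<in>{1..m}. \<forall>u\<in>{1..m}. I (Cont (s j (l j)) (t u (k u))))))"
proof -
  define Q where "Q l k \<longleftrightarrow>
        (\<forall>u\<in>{1..m}. \<forall>j\<in>{1..u}. I (Cont (s j (l j)) (s u (l u))) \<and> I (Cont (t j (k j)) (t u (k u)))) \<and>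
        (\<forall>j\<in>{1..m}. \<forall>u\<in>{1..m}. I (Cont (s j (l j)) (t u (k u))))" for l k
  have Q_cong: "Q l k \<longleftrightarrow> Q l' k'"
    if "\<And>j. j \<in> {1..m} \<Longrightarrow> l j = l' j" "\<And>j. j \<in> {1..m} \<Longrightarrow> k j = k' j" for l k l' k'
    unfolding Q_def using that by (intro arg_cong2[where f = "(\<and>)"] ball_cong) auto
  have choose: "(\<exists>l\<in>set (choices m i). \<exists>k\<in>set (choices m i). Q l k) \<longleftrightarrow>
      (\<exists>l k. (\<forall>j\<in>{1..m}. l j \<in> {1..i} \<and> k j \<in> {1..i}) \<and> Q l k)" (is "?L \<longleftrightarrow> ?R")
  proof
    show "?L \<Longrightarrow> ?R"
      using choices_range by blast
    assume ?R
    then obtain l k where lk: "\<And>j. j \<in> {1..m} \<Longrightarrow> l j \<in> {1..i}"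
      "\<And>j. j \<in> {1..m} \<Longrightarrow> k j \<in> {1..i}" "Q l k"
      by blast
    obtain l' where "l' \<in> set (choices m i)" "\<And>j. j \<in> {1..m} \<Longrightarrow> l' j = l j"
      using choices_complete lk(1) by metis
    moreover obtain k' where "k' \<in> set (choices m i)" "\<And>j. j \<in> {1..m} \<Longrightarrow> k' j = k j"
      using choices_complete lk(2) by metis
    ultimately show ?L
      using Q_cong lk(3) by metis
  qed
  have "eval_prop I (A1_fm m i x y s t) \<longleftrightarrow>
    (I (Cont x y) \<and>
     (\<forall>j\<in>{1..m}. I (Leq x (sum_upto (\<^bold>+) (s j) i)) \<and> I (Leq y (sum_upto (\<^bold>+) (t j) i))) \<longrightarrow>
     (\<exists>l\<in>set (choices m i). \<exists>k\<in>set (choices m i). Q l k))"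
    unfolding A1_fm_def Q_def
    by (simp del: upt_Suc add: atLeastLessThanSuc_atLeastAtMost)
  then show ?thesis
    unfolding choose unfolding Q_def imp_conjL by assumption
qed

lemma eval_prop_A_fm:
  "eval_prop I (A_fm n i t u x) \<longleftrightarrow>
    (\<not> I (Leq t u) \<longrightarrow> (\<forall>k\<in>{1..n}. I (Leq t (sum_upto (\<^bold>+) (x k) i))) \<longrightarrow>
     (\<exists>j. (\<forall>k\<in>{1..n}. j k \<in> {1..i}) \<and>
        (\<forall>k\<in>{1..n}. \<not> I (Leq (x k (j k)) u)) \<and>
        (\<forall>k\<in>{1..n}. \<forall>l\<in>{1..n}. I (Cont (x k (j k)) (x l (j l))))))"
proof -
  define Q where "Q j \<longleftrightarrow> (\<forall>k\<in>{1..n}. \<not> I (Leq (x k (j k)) u)) \<and>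
        (\<forall>k\<in>{1..n}. \<forall>l\<in>{1..n}. I (Cont (x k (j k)) (x l (j l))))" for j
  have Q_cong: "Q j \<longleftrightarrow> Q j'" if "\<And>k. k \<in> {1..n} \<Longrightarrow> j k = j' k" for j j'
    unfolding Q_def using that by simp
  have choose: "(\<exists>j\<in>set (choices n i). Q j) \<longleftrightarrow> (\<exists>j. (\<forall>k\<in>{1..n}. j k \<in> {1..i}) \<and> Q j)"
    (is "?L \<longleftrightarrow> ?R")
  proof
    show "?L \<Longrightarrow> ?R"
      using choices_range by blast
    assume ?R
    then obtain j where j: "\<And>k. k \<in> {1..n} \<Longrightarrow> j k \<in> {1..i}" "Q j"
      by blast
    obtain j' where "j' \<in> set (choices n i)" "\<And>k. k \<in> {1..n} \<Longrightarrow> j' k = j k"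
      using choices_complete j(1) by metis
    then show ?L
      using Q_cong j(2) by metis
  qed
  have "eval_prop I (A_fm n i t u x) \<longleftrightarrow>
    (\<not> I (Leq t u) \<and> (\<forall>k\<in>{1..n}. I (Leq t (sum_upto (\<^bold>+) (x k) i))) \<longrightarrow>
     (\<exists>j\<in>set (choices n i). Q j))"
    unfolding A_fm_def Q_def
    by (simp del: upt_Suc add: atLeastLessThanSuc_atLeastAtMost)
  then show ?thesis
    unfolding choose unfolding Q_def imp_conjL by assumption
qed


section \<open>Soundness\<close>

context L_structure
begin

lemma eval_trm_closed: "range v \<subseteq> carrier S \<Longrightarrow> eval_trm S v t \<in> carrier S"
  by (induction t) (auto intro: zero_closed one_closed plus_closed)

lemma sum_upto_closed:
  assumes "i \<ge> 1" "\<And>a. a \<in> {1..i} \<Longrightarrow> f a \<in> carrier S"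
  shows "sum_upto (\<oplus>) f i \<in> carrier S"
  using sum_upto_hom[of i f "carrier S" "(\<oplus>)" "\<lambda>x. x" "(\<oplus>)"] assms plus_closed by simp

end

lemma (in CJS) CJS_axiom_sound:
  assumes "CJS_axiom \<psi>" and v: "range v \<subseteq> carrier S"
  shows "eval_prop (eval_atm S v) \<psi>"
proof -
  note closed = eval_trm_closed[OF v]
  show ?thesis
    using assms(1)
  proof cases
    case c: (le_antisym x y)
    then show ?thesis
      using le_antisym[of "eval_trm S v x" "eval_trm S v y"] closed by simp
  next
    case c: (le_trans x y z)
    then show ?thesis
      using le_trans[of "eval_trm S v x" "eval_trm S v y"] closed by auto
  next
    case c: (contact_nonzero x y)
    then show ?thesis
      using contact_nonzero[of "eval_trm S v x" "eval_trm S v y"] closed by auto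
  next
    case (A1 m i x y s t)
    show ?thesis
      unfolding A1(1) eval_prop_A1_fm eval_atm.simps eval_trm_sum_upto[OF A1(3)]
      by (intro impI ax_A1[of m i "eval_trm S v x" "eval_trm S v y"
          "\<lambda>j a. eval_trm S v (s j a)" "\<lambda>j a. eval_trm S v (t j a)"])
        (use A1(2,3) in \<open>simp_all add: closed\<close>)
  next
    case (A n i t u x)
    show ?thesis
      unfolding A(1) eval_prop_A_fm eval_atm.simps eval_trm_sum_upto[OF A(3)]
      by (intro impI ax_A[of n i "eval_trm S v t" "eval_trm S v u" "\<lambda>k a. eval_trm S v (x k a)"])
        (use A(2,3) in \<open>simp_all add: closed\<close>)
  qed (simp_all add: closed le_refl plus_comm le_plus plus_least
        zero_le le_one contact_sym)
qed

lemma (in CJS) sound: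
  assumes "\<turnstile> \<phi>"
  shows "S \<Turnstile> \<phi>"
proof -
  have "eval_prop (eval_atm S v) \<phi>" if "range v \<subseteq> carrier S" for v
    using assms
  proof induction
    case (taut \<phi>)
    then show ?case by (simp add: tautology_def)
  next
    case (equality \<phi>)
    then show ?case by cases auto
  next
    case (CJS \<phi>)
    then show ?case using CJS_axiom_sound that by blast
  qed simp
  then show ?thesis
    by (simp add: true_in_def)
qed

lemma (in pre_CJS) le_sum_upto:
  assumes "i \<ge> 1" "\<And>a. a \<in> {1..i} \<Longrightarrow> f a \<in> carrier S" "a \<in> {1..i}"
  shows "f a \<preceq> sum_upto (\<oplus>) f i"
  using assms
proof (induction i rule: nat_induct_at_least)
  case base
  then show ?case by (simp add: le_refl)
next
  case (Suc i)
  have closed: "sum_upto (\<oplus>) f i \<in> carrier S" "f (Suc i) \<in> carrier S"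
    using Suc.prems Suc.hyps by (auto intro!: sum_upto_closed)
  show ?case
  proof (cases "a = Suc i")
    case True
    then show ?thesis
      using closed le_plus[of "f (Suc i)" "sum_upto (\<oplus>) f i"] plus_comm Suc.hyps
      by (simp add: sum_upto_Suc)
  next
    case False
    then have "f a \<preceq> sum_upto (\<oplus>) f i"
      using Suc by simp
    then show ?thesis
      using closed Suc.prems Suc.hyps le_plus[OF closed] plus_closed[OF closed]
      by (simp add: sum_upto_Suc) (metis Suc.prems(1) Suc.prems(2) le_trans)
  qed
qed

section \<open>From additive decomposition to the schemes\<close>

context DCJS
begin

text \<open>A property that a sum has only if one of its summands has it can be pushed down, by
  additive decomposition, to a part that lies below one summand of each given sum.\<close>

lemma split_sum:
  assumes prime: "\<And>a b. \<lbrakk>a \<in> carrier S; b \<in> carrier S; P (a \<oplus> b)\<rbrakk> \<Longrightarrow> P a \<or> P b"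
    and "i \<ge> 1" "\<And>a. a \<in> {1..i} \<Longrightarrow> f a \<in> carrier S"
    and "x \<in> carrier S" "P x" "x \<preceq> sum_upto (\<oplus>) f i"
  shows "\<exists>x'\<in>carrier S. x' \<preceq> x \<and> P x' \<and> (\<exists>a\<in>{1..i}. x' \<preceq> f a)"
  using assms(2-)
proof (induction i arbitrary: x rule: nat_induct_at_least)
  case base
  then show ?case using le_refl by auto
next
  case (Suc i)
  have closed: "sum_upto (\<oplus>) f i \<in> carrier S" "f (Suc i) \<in> carrier S"
    using Suc.prems Suc.hyps by (auto intro!: sum_upto_closed)
  obtain a b where ab: "a \<in> carrier S" "b \<in> carrier S" "a \<preceq> sum_upto (\<oplus>) f i" "b \<preceq> f (Suc i)"
    "x = a \<oplus> b"
    using distrib[OF \<open>x \<in> carrier S\<close> closed] Suc.prems Suc.hyps by (auto simp: sum_upto_Suc)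
  have ax: "a \<preceq> x" and bx: "b \<preceq> x"
    using ab le_plus plus_comm by metis+
  consider "P a" | "P b"
    using prime ab Suc.prems by blast
  then show ?case
  proof cases
    case 1
    then obtain x' a' where "x' \<in> carrier S" "x' \<preceq> a" "P x'" "a' \<in> {1..i}" "x' \<preceq> f a'"
      using Suc.IH[of a] Suc.prems ab by auto
    then show ?thesis
      using ax ab Suc.prems(2) le_trans[of x' a x] by fastforce
  next
    case 2
    then show ?thesis
      using bx ab Suc.prems by (intro bexI[of _ b]) auto
  qed
qed

text \<open>The sums are treated one at a time. Choices made for earlier sums survive, because an
  element that is shrunk further stays below the summands already chosen.\<close>

lemma split_sums:
  fixes n :: nat
  assumes prime: "\<And>a b. \<lbrakk>a \<in> carrier S; b \<in> carrier S; P (a \<oplus> b)\<rbrakk> \<Longrightarrow> P a \<or> P b"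
    and i: "i \<ge> 1" and "\<forall>k\<in>{1..n}. \<forall>a\<in>{1..i}. f k a \<in> carrier S"
    and x: "x \<in> carrier S" "P x" and "\<forall>k\<in>{1..n}. x \<preceq> sum_upto (\<oplus>) (f k) i"
  shows "\<exists>x'\<in>carrier S. x' \<preceq> x \<and> P x' \<and> (\<exists>j. \<forall>k\<in>{1..n}. j k \<in> {1..i} \<and> x' \<preceq> f k (j k))"
  using assms(3,6)
proof (induction n)
  case 0
  then show ?case using x le_refl by auto
next
  case (Suc n)
  then obtain y j where y: "y \<in> carrier S" "y \<preceq> x" "P y"
    and j: "\<forall>k\<in>{1..n}. j k \<in> {1..i} \<and> y \<preceq> f k (j k)"
    by auto
  have "sum_upto (\<oplus>) (f (Suc n)) i \<in> carrier S"
    using Suc.prems i by (intro sum_upto_closed) auto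
  then have "y \<preceq> sum_upto (\<oplus>) (f (Suc n)) i"
    using y x Suc.prems le_trans[of y x] by simp
  then obtain z a where z: "z \<in> carrier S" "z \<preceq> y" "P z" "a \<in> {1..i}" "z \<preceq> f (Suc n) a"
    using split_sum[of P i "f (Suc n)" y] prime i y Suc.prems by auto
  have "(j(Suc n := a)) k \<in> {1..i} \<and> z \<preceq> f k ((j(Suc n := a)) k)" if k: "k \<in> {1..Suc n}" for k
  proof (cases "k = Suc n")
    case True
    then show ?thesis using z by simp
  next
    case False
    then have "k \<in> {1..n}" using k by auto
    then show ?thesis
      using j False z y k Suc.prems le_trans[of z y "f k (j k)"] by auto
  qed
  moreover have "z \<preceq> x"
    using z y x le_trans by blast
  ultimately show ?case
    using z by blast
qed

lemma contact_mono2: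
  assumes "x \<in> carrier S" "y \<in> carrier S" "x' \<in> carrier S" "y' \<in> carrier S"
    and "x \<bowtie> y" "x \<preceq> x'" "y \<preceq> y'"
  shows "x' \<bowtie> y'"
  using assms by (meson contact_mono contact_sym)

lemma contact_plus_left:
  "\<lbrakk>x \<in> carrier S; y \<in> carrier S; z \<in> carrier S; y \<oplus> z \<bowtie> x\<rbrakk> \<Longrightarrow> y \<bowtie> x \<or> z \<bowtie> x"
  using contact_plus contact_sym plus_closed by meson

lemma CJS: "CJS S"
proof unfold_locales
  fix m i :: nat and x y s t
  assume "m \<ge> 1" and i: "i \<ge> 1" and x: "x \<in> carrier S" and y: "y \<in> carrier S"
    and st: "\<forall>j\<in>{1..m}. \<forall>a\<in>{1..i}. s j a \<in> carrier S \<and> t j a \<in> carrier S"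
    and "x \<bowtie> y"
    and le: "\<forall>j\<in>{1..m}. x \<preceq> sum_upto (\<oplus>) (s j) i \<and> y \<preceq> sum_upto (\<oplus>) (t j) i"
  \<comment> \<open>Contact with \<open>y\<close> passes from a sum to a summand, so
    \<open>x\<close> can be shrunk below one summand of each of its coverings while staying in
    contact with \<open>y\<close>.\<close>
  have "\<exists>x'\<in>carrier S. x' \<preceq> x \<and> x' \<bowtie> y \<and>
      (\<exists>l. \<forall>j\<in>{1..m}. l j \<in> {1..i} \<and> x' \<preceq> s j (l j))"
  proof (rule split_sums[OF _ i])
    show "a \<bowtie> y \<or> b \<bowtie> y" if "a \<in> carrier S" "b \<in> carrier S" "a \<oplus> b \<bowtie> y" for a b
      using contact_plus_left[OF y that] .
  qed (use x st le \<open>x \<bowtie> y\<close> in auto)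
  then obtain x' l where x': "x' \<in> carrier S" "x' \<bowtie> y"
    and l: "\<forall>j\<in>{1..m}. l j \<in> {1..i} \<and> x' \<preceq> s j (l j)"
    by auto
  \<comment> \<open>Now \<open>y\<close> is shrunk relative to the already shrunk \<open>x'\<close>,
    so that the two parts finally obtained are in contact with each other.\<close>
  have "\<exists>y'\<in>carrier S. y' \<preceq> y \<and> x' \<bowtie> y' \<and>
      (\<exists>k. \<forall>j\<in>{1..m}. k j \<in> {1..i} \<and> y' \<preceq> t j (k j))"
  proof (rule split_sums[OF _ i])
    show "x' \<bowtie> a \<or> x' \<bowtie> b" if "a \<in> carrier S" "b \<in> carrier S" "x' \<bowtie> a \<oplus> b" for a b
      using contact_plus[OF x'(1) that] .
  qed (use x' y st le in auto)
  then obtain y' k where y': "y' \<in> carrier S" "x' \<bowtie> y'"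
    and k: "\<forall>j\<in>{1..m}. k j \<in> {1..i} \<and> y' \<preceq> t j (k j)"
    by auto
  \<comment> \<open>Elements in contact are nonzero and hence in contact with themselves; by
    monotonicity the summands chosen above \<open>x'\<close> are then pairwise in contact, and so
    are those above \<open>y'\<close>.\<close>
  have nz: "x' \<bowtie> x'" "y' \<bowtie> y'"
    using contact_refl contact_nonzero contact_sym x' y' by metis+
  have stc: "s j (l j) \<in> carrier S" "t j (k j) \<in> carrier S" if "j \<in> {1..m}" for j
    using that st l k by auto
  have "s j (l j) \<bowtie> s u (l u) \<and> t j (k j) \<bowtie> t u (k u) \<and> s j (l j) \<bowtie> t u (k u)"
    if ju: "j \<in> {1..m}" "u \<in> {1..m}" for j u
  proof (intro conjI)
    show "s j (l j) \<bowtie> s u (l u)"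
      by (rule contact_mono2[of x' x']) (use ju stc l x' nz in auto)
    show "t j (k j) \<bowtie> t u (k u)"
      by (rule contact_mono2[of y' y']) (use ju stc k y' nz in auto)
    show "s j (l j) \<bowtie> t u (k u)"
      by (rule contact_mono2[of x' y']) (use ju stc l k x' y' in auto)
  qed
  then show "\<exists>l k. (\<forall>j\<in>{1..m}. l j \<in> {1..i} \<and> k j \<in> {1..i}) \<and>
            (\<forall>u\<in>{1..m}. \<forall>j\<in>{1..u}. s j (l j) \<bowtie> s u (l u) \<and> t j (k j) \<bowtie> t u (k u)) \<and>
            (\<forall>j\<in>{1..m}. \<forall>u\<in>{1..m}. s j (l j) \<bowtie> t u (k u))"
    using l k by (intro exI[of _ l] exI[of _ k]) auto
next
  fix n i :: nat and t u x
  assume "n \<ge> 1" and i: "i \<ge> 1" and t: "t \<in> carrier S" and u: "u \<in> carrier S"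
    and x: "\<forall>k\<in>{1..n}. \<forall>a\<in>{1..i}. x k a \<in> carrier S"
    and tu: "\<not> t \<preceq> u" and le: "\<forall>k\<in>{1..n}. t \<preceq> sum_upto (\<oplus>) (x k) i"
  \<comment> \<open>The property pushed down here is not lying below \<open>u\<close>. A sum has it
    only if a summand does, because sums are least upper bounds.\<close>
  have "\<exists>t'\<in>carrier S. t' \<preceq> t \<and> \<not> t' \<preceq> u \<and>
      (\<exists>j. \<forall>k\<in>{1..n}. j k \<in> {1..i} \<and> t' \<preceq> x k (j k))"
  proof (rule split_sums[OF _ i])
    show "\<not> a \<preceq> u \<or> \<not> b \<preceq> u"
      if "a \<in> carrier S" "b \<in> carrier S" "\<not> a \<oplus> b \<preceq> u" for a b
      using plus_least that u by blast
  qed (use t x tu le in auto)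
  then obtain t' j where t': "t' \<in> carrier S" "\<not> t' \<preceq> u"
    and j: "\<forall>k\<in>{1..n}. j k \<in> {1..i} \<and> t' \<preceq> x k (j k)"
    by auto
  \<comment> \<open>\<open>t'\<close> is nonzero, since zero lies below \<open>u\<close>.\<close>
  have "t' \<bowtie> t'"
    using t' u zero_le contact_refl by blast
  then have "x k (j k) \<bowtie> x l (j l)" if "k \<in> {1..n}" "l \<in> {1..n}" for k l
    by (intro contact_mono2[of t' t' "x k (j k)" "x l (j l)"]) (use that j x t' in auto)
  moreover have "\<not> x k (j k) \<preceq> u" if "k \<in> {1..n}" for k
    using that j x t' u le_trans[of t' "x k (j k)" u] by blast
  ultimately show "\<exists>j. (\<forall>k\<in>{1..n}. j k \<in> {1..i}) \<and> (\<forall>k\<in>{1..n}. \<not> x k (j k) \<preceq> u) \<and>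
            (\<forall>k\<in>{1..n}. \<forall>l\<in>{1..n}. x k (j k) \<bowtie> x l (j l))"
    using j by blast
qed

end

section \<open>Regular closed sets and additive decomposition in topological contact
  algebras\<close>

lemma regular_closed_closure_of_open:
  assumes "openin X U"
  shows "X closure_of U \<in> regular_closed X"
proof -
  have "U \<subseteq> X interior_of (X closure_of U)"
    using assms by (simp add: interior_of_maximal closure_of_subset openin_subset)
  then have "X closure_of U \<subseteq> X closure_of (X interior_of (X closure_of U))"
    by (rule closure_of_mono)
  moreover have "X closure_of (X interior_of (X closure_of U)) \<subseteq> X closure_of U"
    by (simp add: closure_of_minimal interior_of_subset)
  ultimately show ?thesis
    by (simp add: regular_closed_def closure_of_subset_topspace)
qed

lemma regular_closed_Un:
  assumes "a \<in> regular_closed X" "b \<in> regular_closed X"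
  shows "a \<union> b \<in> regular_closed X"
proof -
  have "a \<union> b = X closure_of (X interior_of a \<union> X interior_of b)"
    using assms by (simp add: regular_closed_def)
  then show ?thesis
    by (simp only: regular_closed_closure_of_open openin_Un openin_interior_of)
qed

lemma DCJS_top_contact_algebra: "DCJS (top_contact_algebra X)"
proof -
  have decompose: "\<exists>a'\<in>regular_closed X. a' \<subseteq> a \<and> (\<exists>b'\<in>regular_closed X. b' \<subseteq> b \<and> x = a' \<union> b')"
    if x: "x \<in> regular_closed X" and a: "a \<in> regular_closed X" and b: "b \<in> regular_closed X"
      and sub: "x \<subseteq> a \<union> b" for x a b
  proof -
    \<comment> \<open>This is the meet of \<open>x\<close> and \<open>c\<close> among the regular
      closed sets; the intersection itself need not be regular closed.\<close>
    define part where "part c = X closure_of (X interior_of (x \<inter> c))" for c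
    have part: "part c \<in> regular_closed X" "part c \<subseteq> c" "part c \<subseteq> x"
      if "c \<in> regular_closed X" for c
    proof -
      have "X closure_of (X interior_of (x \<inter> c)) \<subseteq> X closure_of (X interior_of d)"
        if "x \<inter> c \<subseteq> d" for d
        using that by (intro closure_of_mono interior_of_mono)
      from this[of c] this[of x] show "part c \<subseteq> c" "part c \<subseteq> x"
        using x that by (simp_all add: part_def regular_closed_def)
      show "part c \<in> regular_closed X"
        unfolding part_def by (simp add: regular_closed_closure_of_open)
    qed
    have "X interior_of x \<subseteq> part a \<union> part b"
    proof -
      \<comment> \<open>\<open>U\<close> is what \<open>part a\<close> leaves of the interior of
        \<open>x\<close>. Being open and disjoint from the interior of \<open>a\<close>, it also
        misses the closure of that interior, which is \<open>a\<close>; hence it lies in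
        \<open>b\<close> and then in \<open>part b\<close>.\<close>
      define U where "U = X interior_of x - part a"
      have U: "openin X U"
        unfolding U_def part_def by (simp add: openin_diff)
      have Ux: "U \<subseteq> x"
        unfolding U_def using interior_of_subset by fastforce
      have "U \<inter> X interior_of a \<subseteq> X interior_of (x \<inter> a)"
        using U Ux interior_of_subset[of X a] by (intro interior_of_maximal) (auto simp: openin_Int)
      moreover have "X interior_of (x \<inter> a) \<subseteq> part a"
        unfolding part_def
        by (meson closure_of_subset openin_interior_of openin_subset)
      ultimately have "U \<inter> X interior_of a = {}"
        unfolding U_def by blast
      then have "U \<inter> X closure_of (X interior_of a) = {}"
        using openin_Int_closure_of_eq_empty[OF U] by blast
      then have "U \<inter> a = {}"
        using a by (simp add: regular_closed_def)
      then have "U \<subseteq> X interior_of (x \<inter> b)"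
        using U Ux sub by (intro interior_of_maximal) auto
      moreover have "X interior_of (x \<inter> b) \<subseteq> part b"
        unfolding part_def
        by (meson closure_of_subset openin_interior_of openin_subset)
      ultimately show ?thesis
        unfolding U_def by blast
    qed
    \<comment> \<open>Both parts are closed, so taking closures turns the inclusion for the interior
      of \<open>x\<close> into one for \<open>x\<close> itself.\<close>
    then have "X closure_of (X interior_of x) \<subseteq> X closure_of (part a \<union> part b)"
      by (rule closure_of_mono)
    moreover have "X closure_of (part a \<union> part b) = part a \<union> part b"
      by (simp add: part_def)
    moreover have "X closure_of (X interior_of x) = x"
      using x by (simp add: regular_closed_def)
    ultimately have "x = part a \<union> part b"
      using part(3)[OF a] part(3)[OF b] by (simp add: subset_antisym)
    then show ?thesis
      using part(1,2)[OF a] part(1,2)[OF b] by (intro bexI conjI)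
  qed
  have constants: "{} \<in> regular_closed X" "topspace X \<in> regular_closed X"
    by (simp_all add: regular_closed_def)
  have sub: "a \<subseteq> topspace X" if "a \<in> regular_closed X" for a
    using that by (simp add: regular_closed_def)
  show ?thesis
    unfolding top_contact_algebra_def
    by unfold_locales (simp_all add: regular_closed_Un constants sub decompose, fast+)
qed

section \<open>Completeness\<close>

text \<open>A set of formulas that contains the theorems, is closed under modus ponens and is maximal
  without \<open>\<phi>\<close> decides every formula, so membership of atoms is a truth assignment.\<close>

definition theory_avoiding :: "fm \<Rightarrow> fm set \<Rightarrow> bool" where
  "theory_avoiding \<phi> \<Gamma> \<longleftrightarrow> (\<forall>\<psi>. \<turnstile> \<psi> \<longrightarrow> \<psi> \<in> \<Gamma>) \<and>
     (\<forall>\<psi> \<chi>. (\<psi> \<^bold>\<longrightarrow> \<chi>) \<in> \<Gamma> \<longrightarrow> \<psi> \<in> \<Gamma> \<longrightarrow> \<chi> \<in> \<Gamma>) \<and> \<phi> \<notin> \<Gamma>"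

lemma maximal_theory_avoiding:
  assumes "\<not> \<turnstile> \<phi>"
  obtains \<Gamma> where "theory_avoiding \<phi> \<Gamma>"
    "\<And>\<Delta>. \<lbrakk>theory_avoiding \<phi> \<Delta>; \<Gamma> \<subseteq> \<Delta>\<rbrakk> \<Longrightarrow> \<Delta> = \<Gamma>"
proof -
  have "theory_avoiding \<phi> {\<psi>. \<turnstile> \<psi>}"
    using assms L_theorem.MP unfolding theory_avoiding_def by blast
  moreover have "\<Union>\<C> \<in> Collect (theory_avoiding \<phi>)"
    if "\<C> \<noteq> {}" and chain: "subset.chain (Collect (theory_avoiding \<phi>)) \<C>" for \<C>
  proof -
    have mem: "theory_avoiding \<phi> \<Gamma>" if "\<Gamma> \<in> \<C>" for \<Gamma>
      using chain that by (auto simp: subset_chain_def)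
    have "\<chi> \<in> \<Union>\<C>" if imp: "(\<psi> \<^bold>\<longrightarrow> \<chi>) \<in> \<Union>\<C>" and ant: "\<psi> \<in> \<Union>\<C>" for \<psi> \<chi>
    proof -
      obtain \<Gamma> where \<Gamma>: "\<Gamma> \<in> \<C>" "(\<psi> \<^bold>\<longrightarrow> \<chi>) \<in> \<Gamma>"
        using imp by blast
      obtain \<Delta> where \<Delta>: "\<Delta> \<in> \<C>" "\<psi> \<in> \<Delta>"
        using ant by blast
      \<comment> \<open>Members of the chain are comparable, so both premises of modus ponens lie in
        a single member.\<close>
      have "\<Gamma> \<subseteq> \<Delta> \<or> \<Delta> \<subseteq> \<Gamma>"
        using chain \<Gamma> \<Delta> by (auto simp: subset_chain_def)
      then obtain \<Theta> where "\<Theta> \<in> \<C>" "(\<psi> \<^bold>\<longrightarrow> \<chi>) \<in> \<Theta>" "\<psi> \<in> \<Theta>"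
        using \<Gamma> \<Delta> by blast
      then show ?thesis
        using mem[of \<Theta>] unfolding theory_avoiding_def by blast
    qed
    moreover have "\<forall>\<psi>. \<turnstile> \<psi> \<longrightarrow> \<psi> \<in> \<Union>\<C>" "\<phi> \<notin> \<Union>\<C>"
      using mem \<open>\<C> \<noteq> {}\<close> unfolding theory_avoiding_def by blast+
    ultimately show ?thesis
      unfolding theory_avoiding_def by blast
  qed
  ultimately obtain \<Gamma> where "\<Gamma> \<in> Collect (theory_avoiding \<phi>)"
    "\<forall>\<Delta>\<in>Collect (theory_avoiding \<phi>). \<Gamma> \<subseteq> \<Delta> \<longrightarrow> \<Delta> = \<Gamma>"
    using subset_Zorn_nonempty[of "Collect (theory_avoiding \<phi>)"] by blast
  then show thesis
    using that by blast
qed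

text \<open>Only a truth assignment to atoms is obtained here, not a structure. Since the equality
  axioms are true under it, a quotient of the terms can later turn it into one.\<close>

lemma Lindenbaum:
  assumes "\<not> \<turnstile> \<phi>"
  obtains I where "\<And>\<psi>. \<turnstile> \<psi> \<Longrightarrow> eval_prop I \<psi>" "\<not> eval_prop I \<phi>"
proof -
  obtain \<Gamma> where \<Gamma>: "theory_avoiding \<phi> \<Gamma>"
    and max: "\<And>\<Delta>. \<lbrakk>theory_avoiding \<phi> \<Delta>; \<Gamma> \<subseteq> \<Delta>\<rbrakk> \<Longrightarrow> \<Delta> = \<Gamma>"
    using maximal_theory_avoiding[OF assms] by blast
  have theorems: "\<psi> \<in> \<Gamma>" if "\<turnstile> \<psi>" for \<psi>
    using \<Gamma> that unfolding theory_avoiding_def by blast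
  have MP: "\<chi> \<in> \<Gamma>" if "(\<psi> \<^bold>\<longrightarrow> \<chi>) \<in> \<Gamma>" "\<psi> \<in> \<Gamma>" for \<psi> \<chi>
    using \<Gamma> that unfolding theory_avoiding_def by blast
  have no: "\<phi> \<notin> \<Gamma>"
    using \<Gamma> unfolding theory_avoiding_def by blast
  have taut1: "\<chi> \<in> \<Gamma>" if "\<psi> \<in> \<Gamma>" "\<And>I. eval_prop I \<psi> \<Longrightarrow> eval_prop I \<chi>" for \<psi> \<chi>
    using MP[OF theorems[OF L_theorem.taut] that(1)] that(2) by (simp add: tautology_def)
  have taut2: "\<xi> \<in> \<Gamma>"
    if "\<psi> \<in> \<Gamma>" "\<chi> \<in> \<Gamma>" "\<And>I. \<lbrakk>eval_prop I \<psi>; eval_prop I \<chi>\<rbrakk> \<Longrightarrow> eval_prop I \<xi>" for \<psi> \<chi> \<xi>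
    using MP[OF taut1[OF that(1), of "\<chi> \<^bold>\<longrightarrow> \<xi>"] that(2)] that(3) by simp
  have imp: "(\<psi> \<^bold>\<longrightarrow> \<phi>) \<in> \<Gamma>" if "\<psi> \<notin> \<Gamma>" for \<psi>
  proof (rule ccontr)
    assume "(\<psi> \<^bold>\<longrightarrow> \<phi>) \<notin> \<Gamma>"
    \<comment> \<open>These are the consequences of \<open>\<Gamma>\<close> with
      \<open>\<psi>\<close> added. Defining them through implications makes closure under modus
      ponens a tautological step. If they avoided \<open>\<phi>\<close>, maximality would put
      \<open>\<psi>\<close> into \<open>\<Gamma>\<close>.\<close>
    define \<Delta> where "\<Delta> = {\<chi>. (\<psi> \<^bold>\<longrightarrow> \<chi>) \<in> \<Gamma>}"
    have sub: "\<Gamma> \<subseteq> \<Delta>"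
      unfolding \<Delta>_def using taut1 by fastforce
    moreover have "\<chi>' \<in> \<Delta>" if "(\<chi> \<^bold>\<longrightarrow> \<chi>') \<in> \<Delta>" "\<chi> \<in> \<Delta>" for \<chi> \<chi>'
      using that taut2[of "\<psi> \<^bold>\<longrightarrow> (\<chi> \<^bold>\<longrightarrow> \<chi>')" "\<psi> \<^bold>\<longrightarrow> \<chi>" "\<psi> \<^bold>\<longrightarrow> \<chi>'"] unfolding \<Delta>_def by simp
    ultimately have "theory_avoiding \<phi> \<Delta>"
      using theorems \<open>(\<psi> \<^bold>\<longrightarrow> \<phi>) \<notin> \<Gamma>\<close> unfolding theory_avoiding_def \<Delta>_def by blast
    then have "\<Delta> = \<Gamma>"
      using max sub by blast
    moreover have "\<psi> \<in> \<Delta>"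
      unfolding \<Delta>_def using theorems[OF L_theorem.taut] by (simp add: tautology_def)
    ultimately show False
      using that by blast
  qed
  have neg: "\<^bold>\<not> \<psi> \<in> \<Gamma> \<longleftrightarrow> \<psi> \<notin> \<Gamma>" for \<psi>
  proof
    assume "\<^bold>\<not> \<psi> \<in> \<Gamma>"
    then show "\<psi> \<notin> \<Gamma>"
      using taut2[of "\<^bold>\<not> \<psi>" \<psi> \<phi>] no by auto
  next
    assume "\<psi> \<notin> \<Gamma>"
    show "\<^bold>\<not> \<psi> \<in> \<Gamma>"
    proof (rule ccontr)
      assume "\<^bold>\<not> \<psi> \<notin> \<Gamma>"
      \<comment> \<open>If \<open>\<psi>\<close> and its negation were both missing,
        \<open>\<Gamma>\<close> would contain the implications from each of them to
        \<open>\<phi>\<close>, and so \<open>\<phi>\<close> itself by case distinction.\<close>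
      then show False
        using taut2[OF imp[OF \<open>\<psi> \<notin> \<Gamma>\<close>] imp, of "\<^bold>\<not> \<psi>" \<phi>] no by auto
    qed
  qed
  have conj: "(\<psi> \<^bold>\<and> \<chi>) \<in> \<Gamma> \<longleftrightarrow> \<psi> \<in> \<Gamma> \<and> \<chi> \<in> \<Gamma>" for \<psi> \<chi>
    using taut1[of "\<psi> \<^bold>\<and> \<chi>" \<psi>] taut1[of "\<psi> \<^bold>\<and> \<chi>" \<chi>] taut2[of \<psi> \<chi> "\<psi> \<^bold>\<and> \<chi>"] by auto
  have disj: "(\<psi> \<^bold>\<or> \<chi>) \<in> \<Gamma> \<longleftrightarrow> \<psi> \<in> \<Gamma> \<or> \<chi> \<in> \<Gamma>" for \<psi> \<chi>
    using taut1[of \<psi> "\<psi> \<^bold>\<or> \<chi>"] taut1[of \<chi> "\<psi> \<^bold>\<or> \<chi>"] taut2[of "\<psi> \<^bold>\<or> \<chi>" "\<^bold>\<not> \<psi>" \<chi>] neg by auto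
  have impl: "(\<psi> \<^bold>\<longrightarrow> \<chi>) \<in> \<Gamma> \<longleftrightarrow> (\<psi> \<in> \<Gamma> \<longrightarrow> \<chi> \<in> \<Gamma>)" for \<psi> \<chi>
    using taut1[of \<chi> "\<psi> \<^bold>\<longrightarrow> \<chi>"] taut1[of "\<^bold>\<not> \<psi>" "\<psi> \<^bold>\<longrightarrow> \<chi>"] MP neg by auto
  have fls: "Fls \<notin> \<Gamma>"
    using taut1[of Fls \<phi>] no by auto
  have "\<psi> \<in> \<Gamma> \<longleftrightarrow> eval_prop (\<lambda>a. Atom a \<in> \<Gamma>) \<psi>" for \<psi>
    by (induction \<psi>) (simp_all add: neg conj disj impl fls)
  then show thesis
    using that theorems no by blast
qed

text \<open>Used to place finite structures and finite spaces on any prescribed infinite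
  type.\<close>

lemma finite_inj_into_infinite:
  assumes "finite A" "infinite (UNIV :: 'b set)"
  obtains f :: "'a \<Rightarrow> 'b" where "inj_on f A"
proof -
  obtain B :: "'b set" where "finite B" "card B = card A"
    using infinite_arbitrarily_large[OF assms(2)] by blast
  then show thesis
    using card_le_inj[OF assms(1)] that by fastforce
qed

section \<open>The quotient of the terms under a truth assignment\<close>

primrec has_one :: "trm \<Rightarrow> bool" where
  "has_one (Var x) \<longleftrightarrow> False"
| "has_one \<^bold>0 \<longleftrightarrow> False"
| "has_one \<^bold>1 \<longleftrightarrow> True"
| "has_one (s \<^bold>+ t) \<longleftrightarrow> has_one s \<or> has_one t"

text \<open>The assignment need not come from a structure. The truth of all theorems makes
  \<open>Equal\<close> a congruence on terms and lets terms act, up to it, as the elements of a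
  CJS.\<close>

locale L_valuation =
  fixes I :: "atm \<Rightarrow> bool"
  assumes valid: "\<turnstile> \<psi> \<Longrightarrow> eval_prop I \<psi>"
begin

abbreviation eq (infix "\<approx>" 50) where "s \<approx> t \<equiv> I (Equal s t)"
abbreviation leq (infix "\<lesssim>" 50) where "s \<lesssim> t \<equiv> I (Leq s t)"
abbreviation cont (infix "\<asymp>" 50) where "s \<asymp> t \<equiv> I (Cont s t)"

lemmas equality_valid = valid[OF L_theorem.equality] and CJS_valid = valid[OF L_theorem.CJS]

lemma eq_refl: "s \<approx> s"
  using equality_valid[OF equality_axiom.refl] by simp

lemma eq_sym: "s \<approx> t \<Longrightarrow> t \<approx> s"
  using equality_valid[OF equality_axiom.sym] by simp

lemma eq_trans: "\<lbrakk>s \<approx> t; t \<approx> u\<rbrakk> \<Longrightarrow> s \<approx> u"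
  using equality_valid[OF equality_axiom.trans[of s t u]] by simp

lemma plus_cong: "\<lbrakk>s \<approx> s'; t \<approx> t'\<rbrakk> \<Longrightarrow> s \<^bold>+ t \<approx> s' \<^bold>+ t'"
  using equality_valid[OF equality_axiom.plus_cong[of s s' t t']] by simp

lemma leq_cong: "\<lbrakk>s \<approx> s'; t \<approx> t'\<rbrakk> \<Longrightarrow> s \<lesssim> t \<longleftrightarrow> s' \<lesssim> t'"
  using equality_valid[OF equality_axiom.le_cong[of s s' t t']]
    equality_valid[OF equality_axiom.le_cong[of s' s t' t]] eq_sym by auto

lemma cont_cong: "\<lbrakk>s \<approx> s'; t \<approx> t'\<rbrakk> \<Longrightarrow> s \<asymp> t \<longleftrightarrow> s' \<asymp> t'"
  using equality_valid[OF equality_axiom.contact_cong[of s s' t t']]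
    equality_valid[OF equality_axiom.contact_cong[of s' s t' t]] eq_sym by auto

lemma leq_refl: "s \<lesssim> s"
  using CJS_valid[OF CJS_axiom.le_refl] by simp

lemma leq_antisym: "\<lbrakk>s \<lesssim> t; t \<lesssim> s\<rbrakk> \<Longrightarrow> s \<approx> t"
  using CJS_valid[OF CJS_axiom.le_antisym[of s t]] by simp

lemma leq_trans: "\<lbrakk>s \<lesssim> t; t \<lesssim> u\<rbrakk> \<Longrightarrow> s \<lesssim> u"
  using CJS_valid[OF CJS_axiom.le_trans[of s t u]] by simp

lemma plus_comm: "s \<^bold>+ t \<approx> t \<^bold>+ s"
  using CJS_valid[OF CJS_axiom.plus_comm] by simp

lemma leq_plus: "s \<lesssim> s \<^bold>+ t"
  using CJS_valid[OF CJS_axiom.le_plus] by simp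

lemma leq_plus2: "t \<lesssim> s \<^bold>+ t"
  using leq_plus leq_cong[OF eq_refl plus_comm] by blast

lemma plus_least: "\<lbrakk>s \<lesssim> u; t \<lesssim> u\<rbrakk> \<Longrightarrow> s \<^bold>+ t \<lesssim> u"
  using CJS_valid[OF CJS_axiom.plus_least[of s u t]] by simp

lemma zero_leq: "\<^bold>0 \<lesssim> s"
  using CJS_valid[OF CJS_axiom.zero_le] by simp

lemma leq_one: "s \<lesssim> \<^bold>1"
  using CJS_valid[OF CJS_axiom.le_one] by simp

lemma cont_nonzero: "s \<asymp> t \<Longrightarrow> \<not> s \<approx> \<^bold>0"
  using CJS_valid[OF CJS_axiom.contact_nonzero[of s t]] by simp

lemma cont_sym: "s \<asymp> t \<Longrightarrow> t \<asymp> s"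
  using CJS_valid[OF CJS_axiom.contact_sym[of s t]] by simp

lemma leq_if_vars_leq:
  "\<lbrakk>\<not> has_one s; \<And>x. x \<in> vars_trm s \<Longrightarrow> Var x \<lesssim> u\<rbrakk> \<Longrightarrow> s \<lesssim> u"
  by (induction s) (auto intro: zero_leq plus_least)

lemma var_leq: "x \<in> vars_trm t \<Longrightarrow> Var x \<lesssim> t"
  by (induction t) (auto intro: leq_refl leq_trans leq_plus leq_plus2)

lemma one_leq: "has_one t \<Longrightarrow> \<^bold>1 \<lesssim> t"
  by (induction t) (auto intro: leq_refl leq_trans leq_plus leq_plus2)

text \<open>A term containing \<open>1\<close> equals \<open>1\<close> whatever its variables. Any
  other term is the least upper bound of its variables, so two such terms with the same variables
  lie below each other.\<close>

lemma eq_if_same_vars: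
  assumes "has_one s \<longleftrightarrow> has_one t" "vars_trm s = vars_trm t \<or> has_one s"
  shows "s \<approx> t"
proof (cases "has_one s")
  case True
  then show ?thesis
    using assms leq_antisym leq_trans[OF leq_one one_leq] by simp
next
  case False
  then show ?thesis
    using assms leq_antisym leq_if_vars_leq[of s t] leq_if_vars_leq[of t s] var_leq by simp
qed

text \<open>The class of a term depends only on its \<open>key\<close>: \<open>None\<close> for all
  terms containing \<open>1\<close>, and otherwise the set of variables. Over \<open>V\<close> this
  leaves one key more than there are subsets of \<open>V\<close>. The classes are finally renamed by
  elements of the given type.\<close>

lemma finite_quotient:
  assumes V: "finite V" and "infinite (UNIV :: 'f set)"
  obtains g :: "trm \<Rightarrow> 'f"
  where "\<And>s t. \<lbrakk>vars_trm s \<subseteq> V; vars_trm t \<subseteq> V\<rbrakk> \<Longrightarrow> g s = g t \<longleftrightarrow> s \<approx> t"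
    and "finite (g ` {t. vars_trm t \<subseteq> V})" "card (g ` {t. vars_trm t \<subseteq> V}) \<le> 2 ^ card V + 1"
proof -
  define T where "T = {t. vars_trm t \<subseteq> V}"
  define K where "K = insert None (Some ` Pow V)"
  define key where "key t = (if has_one t then None else Some (vars_trm t))" for t
  define cls where "cls t = {s. s \<approx> t}" for t
  have K: "finite K" "card K = 2 ^ card V + 1"
    unfolding K_def using V by (simp_all add: card_image card_Pow)
  have keyT: "key ` T \<subseteq> K"
    by (auto simp: key_def T_def K_def)
  \<comment> \<open>The class is recovered from the key through an arbitrarily chosen term with that
    key.\<close>
  have "\<exists>F. \<forall>t. cls t = F (key t)"
  proof (intro exI allI)
    fix t
    define s where "s = (SOME s. key s = key t)"
    have "key s = key t"
      unfolding s_def by (rule someI[of "\<lambda>s. key s = key t" t]) simp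
    then have "t \<approx> s"
      by (intro eq_if_same_vars) (auto simp: key_def split: if_splits)
    then have "cls t = cls s"
      unfolding cls_def using eq_sym eq_trans by blast
    then show "cls t = (\<lambda>k. cls (SOME s. key s = k)) (key t)"
      unfolding s_def .
  qed
  then obtain F where F: "\<And>t. cls t = F (key t)"
    by blast
  have "cls ` T \<subseteq> F ` K"
    using keyT F by auto
  then have cls: "finite (cls ` T)" "card (cls ` T) \<le> 2 ^ card V + 1"
    using K finite_subset[of "cls ` T" "F ` K"] card_mono[of "F ` K" "cls ` T"] card_image_le[of K F] by auto
  obtain f :: "trm set \<Rightarrow> 'f" where f: "inj_on f (cls ` T)"
    using finite_inj_into_infinite cls(1) assms(2) by blast
  show thesis
  proof
    show "(f \<circ> cls) s = (f \<circ> cls) t \<longleftrightarrow> s \<approx> t" if "vars_trm s \<subseteq> V" "vars_trm t \<subseteq> V" for s t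
    proof -
      have "(f \<circ> cls) s = (f \<circ> cls) t \<longleftrightarrow> cls s = cls t"
        using inj_onD[OF f] that by (auto simp: T_def)
      also have "\<dots> \<longleftrightarrow> s \<approx> t"
        unfolding cls_def using eq_refl eq_sym eq_trans by blast
      finally show ?thesis .
    qed
    show "finite ((f \<circ> cls) ` {t. vars_trm t \<subseteq> V})"
      using cls(1) by (simp only: image_comp[symmetric] T_def[symmetric] finite_imageI)
    show "card ((f \<circ> cls) ` {t. vars_trm t \<subseteq> V}) \<le> 2 ^ card V + 1"
      using cls(2) f by (simp only: image_comp[symmetric] T_def[symmetric] card_image)
  qed
qed

text \<open>Operations and relations are computed on representatives \<open>r b\<close>, and
  congruence makes the choice harmless. A sum in the structure becomes a sum of representatives, so
  each required instance of a scheme is one that is true under \<open>I\<close> for terms.\<close>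

lemma ex_finite_CJS:
  assumes V: "finite V" and "infinite (UNIV :: 'f set)"
  obtains S :: "'f struct" and v
  where "CJS S" "finite (carrier S)" "card (carrier S) \<le> 2 ^ card V + 1" "range v \<subseteq> carrier S"
    "\<And>\<psi>. vars \<psi> \<subseteq> V \<Longrightarrow> eval_prop (eval_atm S v) \<psi> \<longleftrightarrow> eval_prop I \<psi>"
proof -
  define T where "T = {t. vars_trm t \<subseteq> V}"
  obtain g :: "trm \<Rightarrow> 'f"
    where g_eq: "\<And>s t. \<lbrakk>s \<in> T; t \<in> T\<rbrakk> \<Longrightarrow> g s = g t \<longleftrightarrow> s \<approx> t"
      and fin: "finite (g ` T)" "card (g ` T) \<le> 2 ^ card V + 1"
    using finite_quotient[OF assms] unfolding T_def by (metis mem_Collect_eq)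
  have T: "\<^bold>0 \<in> T" "\<^bold>1 \<in> T" "s \<^bold>+ t \<in> T \<longleftrightarrow> s \<in> T \<and> t \<in> T" for s t
    by (auto simp: T_def)
  define r where "r b = (SOME t. t \<in> T \<and> g t = b)" for b
  have r: "r b \<in> T" "g (r b) = b" if "b \<in> g ` T" for b
    using someI_ex[of "\<lambda>t. t \<in> T \<and> g t = b"] that unfolding r_def by blast+
  have rg: "r (g t) \<approx> t" if "t \<in> T" for t
    using r[of "g t"] g_eq that by blast
  define S where "S = \<lparr>carrier = g ` T, le = (\<lambda>a b. r a \<lesssim> r b), zero = g \<^bold>0, one = g \<^bold>1,
    plus = (\<lambda>a b. g (r a \<^bold>+ r b)), contact = (\<lambda>a b. r a \<asymp> r b)\<rparr>"
  have carr: "carrier S = g ` T"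
    by (simp add: S_def)
  have zero: "zero S = g \<^bold>0" and one: "one S = g \<^bold>1"
    by (simp_all add: S_def)
  have plus: "plus S (g s) (g t) = g (s \<^bold>+ t)" if "s \<in> T" "t \<in> T" for s t
    using that r[of "g s"] r[of "g t"] rg plus_cong g_eq T by (simp add: S_def)
  have le: "le S (g s) (g t) \<longleftrightarrow> s \<lesssim> t" and contact: "contact S (g s) (g t) \<longleftrightarrow> s \<asymp> t"
    if "s \<in> T" "t \<in> T" for s t
    using that leq_cong cont_cong rg by (simp_all add: S_def)
  have sum: "sum_upto (\<^bold>+) f i \<in> T \<and> g (sum_upto (\<^bold>+) f i) = sum_upto (plus S) (\<lambda>a. g (f a)) i"
    if "i \<ge> 1" "\<And>a. a \<in> {1..i} \<Longrightarrow> f a \<in> T" for i f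
    using sum_upto_hom[of i f T "(\<^bold>+)" g "plus S"] that T plus by simp
  have sum_r: "sum_upto (\<^bold>+) (\<lambda>a. r (f a)) i \<in> T"
    "sum_upto (plus S) f i = g (sum_upto (\<^bold>+) (\<lambda>a. r (f a)) i)"
    if i: "i \<ge> 1" and f: "\<And>a. a \<in> {1..i} \<Longrightarrow> f a \<in> carrier S" for i f
  proof -
    have *: "sum_upto (\<^bold>+) (\<lambda>a. r (f a)) i \<in> T \<and>
        g (sum_upto (\<^bold>+) (\<lambda>a. r (f a)) i) = sum_upto (plus S) (\<lambda>a. g (r (f a))) i"
      by (rule sum) (use f r carr i in auto)
    have "sum_upto (plus S) f i = sum_upto (plus S) (\<lambda>a. g (r (f a))) i"
      by (rule sum_upto_cong) (use f r carr i in auto)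
    then show "sum_upto (\<^bold>+) (\<lambda>a. r (f a)) i \<in> T"
      "sum_upto (plus S) f i = g (sum_upto (\<^bold>+) (\<lambda>a. r (f a)) i)"
      using * by simp_all
  qed
  have le_r: "le S x y \<longleftrightarrow> r x \<lesssim> r y" and contact_r: "contact S x y \<longleftrightarrow> r x \<asymp> r y" for x y
    by (simp_all add: S_def)
  have le_sum: "le S x (sum_upto (plus S) f i) \<longleftrightarrow> r x \<lesssim> sum_upto (\<^bold>+) (\<lambda>a. r (f a)) i"
    if "i \<ge> 1" "\<And>a. a \<in> {1..i} \<Longrightarrow> f a \<in> carrier S" "x \<in> carrier S" for x i f
    using le[of "r x" "sum_upto (\<^bold>+) (\<lambda>a. r (f a)) i"] that sum_r[OF that(1,2)] r[of x] carr
    by simp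
  have "pre_CJS S"
  proof unfold_locales
    show "zero S \<in> carrier S" "one S \<in> carrier S"
      using T by (simp_all add: S_def)
    fix x assume "x \<in> carrier S"
    then obtain s where s: "s \<in> T" "x = g s"
      using carr by auto
    show "le S x x" "le S (zero S) x" "le S x (one S)"
      using s T by (simp_all add: zero one le leq_refl zero_leq leq_one)
    fix y assume "y \<in> carrier S"
    then obtain t where t: "t \<in> T" "y = g t"
      using carr by auto
    show "plus S x y \<in> carrier S" "plus S x y = plus S y x" "le S x (plus S x y)"
      using s t T g_eq plus_comm by (simp_all add: plus le leq_plus carr)
    show "x = y" if "le S x y" "le S y x"
      using that s t leq_antisym by (simp add: le g_eq)
    show "x \<noteq> zero S" if "contact S x y"
      using that s t T cont_nonzero by (simp add: zero contact g_eq)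
    show "contact S y x" if "contact S x y"
      using that s t cont_sym by (simp add: contact)
    fix z assume "z \<in> carrier S"
    then obtain u where u: "u \<in> T" "z = g u"
      using carr by auto
    show "le S x z" if "le S x y" "le S y z"
      using that s t u leq_trans by (simp add: le)
    show "le S (plus S x y) z" if "le S x z" "le S y z"
      using that s t u T plus_least by (simp add: le plus)
  qed
  then interpret pre_CJS S .
  have "CJS S"
  proof unfold_locales
    fix m i :: nat and x y s t
    assume mi: "m \<ge> 1" "i \<ge> 1" and x: "x \<in> carrier S" and y: "y \<in> carrier S"
      and st: "\<forall>j\<in>{1..m}. \<forall>a\<in>{1..i}. s j a \<in> carrier S \<and> t j a \<in> carrier S"
      and "contact S x y"
      and "\<forall>j\<in>{1..m}. le S x (sum_upto (plus S) (s j) i) \<and> le S y (sum_upto (plus S) (t j) i)"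
    then have "r x \<asymp> r y"
      and "\<forall>j\<in>{1..m}. r x \<lesssim> sum_upto (\<^bold>+) (\<lambda>a. r (s j a)) i \<and> r y \<lesssim> sum_upto (\<^bold>+) (\<lambda>a. r (t j a)) i"
      using le_sum by (simp_all add: contact_r)
    then show "\<exists>l k. (\<forall>j\<in>{1..m}. l j \<in> {1..i} \<and> k j \<in> {1..i}) \<and>
            (\<forall>u\<in>{1..m}. \<forall>j\<in>{1..u}.
               contact S (s j (l j)) (s u (l u)) \<and> contact S (t j (k j)) (t u (k u))) \<and>
            (\<forall>j\<in>{1..m}. \<forall>u\<in>{1..m}. contact S (s j (l j)) (t u (k u)))"
      using CJS_valid[OF CJS_axiom.A1[OF mi, of "r x" "r y" "\<lambda>j a. r (s j a)" "\<lambda>j a. r (t j a)"]]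
      unfolding eval_prop_A1_fm contact_r by simp
  next
    fix n i :: nat and t u x
    assume ni: "n \<ge> 1" "i \<ge> 1" and t: "t \<in> carrier S" and u: "u \<in> carrier S"
      and x: "\<forall>k\<in>{1..n}. \<forall>a\<in>{1..i}. x k a \<in> carrier S"
      and "\<not> le S t u" and "\<forall>k\<in>{1..n}. le S t (sum_upto (plus S) (x k) i)"
    then have "\<not> r t \<lesssim> r u" and "\<forall>k\<in>{1..n}. r t \<lesssim> sum_upto (\<^bold>+) (\<lambda>a. r (x k a)) i"
      using le_sum by (simp_all add: le_r)
    then show "\<exists>j. (\<forall>k\<in>{1..n}. j k \<in> {1..i}) \<and> (\<forall>k\<in>{1..n}. \<not> le S (x k (j k)) u) \<and>
            (\<forall>k\<in>{1..n}. \<forall>l\<in>{1..n}. contact S (x k (j k)) (x l (j l)))"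
      using CJS_valid[OF CJS_axiom.A[OF ni, of "r t" "r u" "\<lambda>k a. r (x k a)"]]
      unfolding eval_prop_A_fm contact_r le_r by simp
  qed
  \<comment> \<open>Variables outside \<open>V\<close> get a default value in the carrier, so that
    \<open>v\<close> is a valuation in \<open>S\<close>.\<close>
  define v where "v x = (if x \<in> V then g (Var x) else zero S)" for x
  have v: "range v \<subseteq> carrier S"
    using T by (auto simp: v_def carr zero T_def)
  have trm: "eval_trm S v t = g t" if "t \<in> T" for t
    using that by (induction t) (auto simp: v_def zero one plus T T_def)
  have atm: "eval_atm S v a \<longleftrightarrow> I a" if "vars_atm a \<subseteq> V" for a
    using that by (cases a) (auto simp: T_def g_eq le contact trm)
  have "eval_prop (eval_atm S v) \<psi> \<longleftrightarrow> eval_prop I \<psi>" if "vars \<psi> \<subseteq> V" for \<psi>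
    using that by (induction \<psi>) (auto simp: atm)
  then show thesis
    using that \<open>CJS S\<close> v fin carr by simp
qed

end

lemma finite_vars_trm: "finite (vars_trm t)"
  by (induction t) auto

lemma finite_vars: "finite (vars \<phi>)"
proof (induction \<phi>)
  case (Atom a)
  then show ?case by (cases a) (simp_all add: finite_vars_trm)
qed auto

theorem finite_countermodel:
  assumes "\<not> \<turnstile> \<phi>" and "infinite (UNIV :: 'f set)"
  obtains S :: "'f struct"
  where "CJS S" "finite (carrier S)" "card (carrier S) \<le> 2 ^ card (vars \<phi>) + 1" "\<not> S \<Turnstile> \<phi>"
proof -
  obtain I where I: "\<And>\<psi>. \<turnstile> \<psi> \<Longrightarrow> eval_prop I \<psi>" "\<not> eval_prop I \<phi>"
    using Lindenbaum[OF assms(1)] by blast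
  interpret L_valuation I
    using I(1) by unfold_locales
  obtain S :: "'f struct" and v
    where S: "CJS S" "finite (carrier S)" "card (carrier S) \<le> 2 ^ card (vars \<phi>) + 1"
      and "range v \<subseteq> carrier S" "eval_prop (eval_atm S v) \<phi> \<longleftrightarrow> eval_prop I \<phi>"
    using ex_finite_CJS[OF finite_vars assms(2)] by (metis order_refl)
  then have "\<not> S \<Turnstile> \<phi>"
    using I(2) unfolding true_in_def by blast
  then show thesis
    using that S by blast
qed

section \<open>Embedding a finite CJS into a topological contact algebra\<close>

text \<open>As formulas are quantifier-free, a valuation \<open>v\<close> in \<open>S\<close> and
  the valuation \<open>h \<circ> v\<close> in \<open>T\<close> give every formula the same truth
  value.\<close>

lemma true_in_embedding:
  assumes S: "L_structure S" and T: "T \<Turnstile> \<phi>"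
    and h: "h ` carrier S \<subseteq> carrier T" "inj_on h (carrier S)"
      "h (zero S) = zero T" "h (one S) = one T"
    and plus: "\<And>x y. \<lbrakk>x \<in> carrier S; y \<in> carrier S\<rbrakk> \<Longrightarrow> h (plus S x y) = plus T (h x) (h y)"
    and le: "\<And>x y. \<lbrakk>x \<in> carrier S; y \<in> carrier S\<rbrakk> \<Longrightarrow> le T (h x) (h y) \<longleftrightarrow> le S x y"
    and contact: "\<And>x y. \<lbrakk>x \<in> carrier S; y \<in> carrier S\<rbrakk> \<Longrightarrow> contact T (h x) (h y) \<longleftrightarrow> contact S x y"
  shows "S \<Turnstile> \<phi>"
  unfolding true_in_def
proof (intro allI impI)
  interpret L_structure S by (rule S)
  fix v :: "nat \<Rightarrow> _" assume v: "range v \<subseteq> carrier S"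
  have trm: "eval_trm T (h \<circ> v) t = h (eval_trm S v t)" for t
    using eval_trm_closed[OF v] by (induction t) (simp_all add: h plus)
  have atm: "eval_atm T (h \<circ> v) a \<longleftrightarrow> eval_atm S v a" for a
    using eval_trm_closed[OF v] by (cases a) (simp_all add: trm le contact inj_on_eq_iff[OF h(2)])
  have "eval_prop (eval_atm T (h \<circ> v)) \<psi> \<longleftrightarrow> eval_prop (eval_atm S v) \<psi>" for \<psi>
    by (induction \<psi>) (simp_all del: comp_apply add: atm)
  moreover have "range (h \<circ> v) \<subseteq> carrier T"
    using v h(1) by auto
  ultimately show "eval_prop (eval_atm S v) \<phi>"
    using T unfolding true_in_def by blast
qed

text \<open>An element \<open>e\<close> stands for the set of elements not below it, which contains a sum only if it
  contains a summand; \<open>clans e e'\<close> says that the sets of \<open>e\<close> and \<open>e'\<close> are in contact elementwise.\<close>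

definition clans :: "'a struct \<Rightarrow> 'a \<Rightarrow> 'a \<Rightarrow> bool" where
  "clans S e e' \<longleftrightarrow>
    (\<forall>x\<in>carrier S. \<forall>y\<in>carrier S. \<not> le S x e \<longrightarrow> \<not> le S y e' \<longrightarrow> contact S x y)"

section \<open>Points of a finite CJS from the schemes\<close>

context CJS
begin

lemma card_carrier_pos: "finite (carrier S) \<Longrightarrow> card (carrier S) \<ge> 1"
  using zero_closed by (auto simp: Suc_le_eq card_gt_0_iff)

text \<open>All nonempty sets are listed with the same number of entries, because the sums in one
  instance of a scheme share a common length \<open>i\<close>.\<close>

lemma ex_join:
  assumes "finite (carrier S)" and A: "A \<subseteq> carrier S" "A \<noteq> {}"
  obtains f where "f ` {1..card (carrier S)} = A"
    "\<And>x. x \<in> A \<Longrightarrow> x \<preceq> sum_upto (\<oplus>) f (card (carrier S))"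
proof -
  obtain h where h: "bij_betw h {1..card (carrier S)} (carrier S)"
    using ex_bij_betw_nat_finite_1[OF assms(1)] by blast
  obtain x0 where x0: "x0 \<in> A"
    using A by blast
  \<comment> \<open>Positions whose element is outside \<open>A\<close> are filled with
    \<open>x0\<close>, so the list has full length but only members of \<open>A\<close>.\<close>
  define f where "f a = (if h a \<in> A then h a else x0)" for a
  have img: "f ` {1..card (carrier S)} = A"
  proof
    show "f ` {1..card (carrier S)} \<subseteq> A"
      using x0 by (auto simp: f_def)
    show "A \<subseteq> f ` {1..card (carrier S)}"
    proof
      fix x assume x: "x \<in> A"
      then have "x \<in> h ` {1..card (carrier S)}"
        using A bij_betw_imp_surj_on[OF h] by blast
      then obtain a where "a \<in> {1..card (carrier S)}" "h a = x"
        by blast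
      then show "x \<in> f ` {1..card (carrier S)}"
        using x by (intro image_eqI[of _ _ a]) (auto simp: f_def)
    qed
  qed
  have "f a \<preceq> sum_upto (\<oplus>) f (card (carrier S))" if "a \<in> {1..card (carrier S)}" for a
    using le_sum_upto[of _ f a] card_carrier_pos[OF assms(1)] img A that by blast
  then show thesis
    using that[OF img] img by blast
qed

text \<open>The functions are extensional so that a finite carrier has only finitely many coverings,
  and one instance of a scheme can treat them all.\<close>

definition covers :: "'a \<Rightarrow> (nat \<Rightarrow> 'a) set" where
  "covers t = {f \<in> {1..card (carrier S)} \<rightarrow>\<^sub>E carrier S. t \<preceq> sum_upto (\<oplus>) f (card (carrier S))}"

lemma finite_covers: "finite (carrier S) \<Longrightarrow> finite (covers t)"
  unfolding covers_def by (simp add: finite_PiE)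

lemma restrict_in_covers:
  assumes "finite (carrier S)" "f ` {1..card (carrier S)} \<subseteq> carrier S"
    "t \<preceq> sum_upto (\<oplus>) f (card (carrier S))"
  shows "restrict f {1..card (carrier S)} \<in> covers t"
proof -
  have "sum_upto (\<oplus>) (restrict f {1..card (carrier S)}) (card (carrier S))
      = sum_upto (\<oplus>) f (card (carrier S))"
    using card_carrier_pos[OF assms(1)] by (intro sum_upto_cong) auto
  then show ?thesis
    using assms by (auto simp: covers_def)
qed

lemma covers_nonempty:
  assumes "finite (carrier S)" "t \<in> carrier S"
  shows "covers t \<noteq> {}"
proof -
  obtain f where "f ` {1..card (carrier S)} = carrier S"
    "\<And>x. x \<in> carrier S \<Longrightarrow> x \<preceq> sum_upto (\<oplus>) f (card (carrier S))"
    using ex_join[OF assms(1) subset_refl] zero_closed by blast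
  then show ?thesis
    using restrict_in_covers[of f t] assms by auto
qed

text \<open>\<open>e\<close> is the join of the complement of \<open>G\<close>. If \<open>t\<close>
  were below \<open>e\<close>, a listing of the complement would be a covering of \<open>t\<close>
  that avoids \<open>G\<close>. An element not below \<open>e\<close> cannot lie in the complement,
  and \<open>u\<close>, which does, is below \<open>e\<close>.\<close>

lemma ex_bound_of_complement:
  assumes "finite (carrier S)" and G: "u \<in> carrier S - G"
    and meets: "\<And>f. f \<in> covers t \<Longrightarrow> \<exists>a\<in>{1..card (carrier S)}. f a \<in> G"
  obtains e where "e \<in> carrier S" "u \<preceq> e" "\<not> t \<preceq> e"
    "\<And>x. \<lbrakk>x \<in> carrier S; \<not> x \<preceq> e\<rbrakk> \<Longrightarrow> x \<in> G"
proof -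
  have "carrier S - G \<noteq> {}"
    using G by blast
  then obtain f where f: "f ` {1..card (carrier S)} = carrier S - G"
    and ub: "\<And>x. x \<in> carrier S - G \<Longrightarrow> x \<preceq> sum_upto (\<oplus>) f (card (carrier S))"
    using ex_join[OF assms(1), of "carrier S - G"] by blast
  have "\<not> t \<preceq> sum_upto (\<oplus>) f (card (carrier S))"
    using restrict_in_covers[OF assms(1), of f t] meets[of "restrict f {1..card (carrier S)}"] f by auto
  moreover have "sum_upto (\<oplus>) f (card (carrier S)) \<in> carrier S"
    using card_carrier_pos[OF assms(1)] f by (intro sum_upto_closed) auto
  ultimately show thesis
    using that ub G by blast
qed

text \<open>\<open>ax_A\<close> is applied with one index for each covering of \<open>t\<close>. The
  chosen summands form a set \<open>G\<close> that meets every covering and has pairwise contact.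
  None of them is below \<open>u\<close>, so \<open>u\<close> belongs to the complement of
  \<open>G\<close>.\<close>

lemma separation:
  assumes fin: "finite (carrier S)" and t: "t \<in> carrier S" and u: "u \<in> carrier S"
    and tu: "\<not> t \<preceq> u"
  obtains e where "e \<in> carrier S" "u \<preceq> e" "\<not> t \<preceq> e" "clans S e e"
proof -
  define N where "N = card (carrier S)"
  define n where "n = card (covers t)"
  obtain x where x: "bij_betw x {1..n} (covers t)"
    using ex_bij_betw_nat_finite_1[OF finite_covers[OF fin]] unfolding n_def by blast
  have x_cov: "x k \<in> covers t" if "k \<in> {1..n}" for k
    using x that by (auto simp: bij_betw_def)
  have "n \<ge> 1"
    using finite_covers[OF fin] covers_nonempty[OF fin t]
    by (auto simp: n_def Suc_le_eq card_gt_0_iff)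
  have "N \<ge> 1"
    using card_carrier_pos[OF fin] by (simp add: N_def)
  have carr: "\<forall>k\<in>{1..n}. \<forall>a\<in>{1..N}. x k a \<in> carrier S"
    and le: "\<forall>k\<in>{1..n}. t \<preceq> sum_upto (\<oplus>) (x k) N"
    using x_cov by (fastforce simp: covers_def N_def)+
  obtain j where j: "\<forall>k\<in>{1..n}. j k \<in> {1..N}" "\<forall>k\<in>{1..n}. \<not> x k (j k) \<preceq> u"
    and jC: "\<forall>k\<in>{1..n}. \<forall>l\<in>{1..n}. x k (j k) \<bowtie> x l (j l)"
    using ax_A[of n N t u x, OF \<open>n \<ge> 1\<close> \<open>N \<ge> 1\<close> t u carr tu le] by (elim exE conjE) (rule that)
  define G where "G = (\<lambda>k. x k (j k)) ` {1..n}"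
  have "\<exists>a\<in>{1..N}. f a \<in> G" if "f \<in> covers t" for f
  proof -
    have "f \<in> x ` {1..n}"
      using bij_betw_imp_surj_on[OF x] that by simp
    then obtain k where "k \<in> {1..n}" "x k = f"
      by blast
    then show ?thesis
      using j(1) unfolding G_def by blast
  qed
  moreover have "u \<in> carrier S - G"
    using j le_refl u unfolding G_def by blast
  ultimately obtain e where e: "e \<in> carrier S" "u \<preceq> e" "\<not> t \<preceq> e"
    and eG: "\<And>x. \<lbrakk>x \<in> carrier S; \<not> x \<preceq> e\<rbrakk> \<Longrightarrow> x \<in> G"
    using ex_bound_of_complement[OF fin, of u G t] unfolding N_def by blast
  have "a \<bowtie> b" if "a \<in> G" "b \<in> G" for a b
    using that jC unfolding G_def by blast
  then have "clans S e e"
    using eG unfolding clans_def by blast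
  then show thesis
    using that e by blast
qed

text \<open>The construction of \<open>separation\<close> is carried out for \<open>x\<close> and
  \<open>y\<close> simultaneously, with \<open>ax_A1\<close> also providing contact between the two
  sets of chosen summands.\<close>

lemma contact_witness:
  assumes fin: "finite (carrier S)" and x: "x \<in> carrier S" and y: "y \<in> carrier S"
    and xy: "x \<bowtie> y"
  obtains e e' where "e \<in> carrier S" "e' \<in> carrier S" "\<not> x \<preceq> e" "\<not> y \<preceq> e'"
    "clans S e e" "clans S e' e'" "clans S e e'"
proof -
  define N where "N = card (carrier S)"
  \<comment> \<open>\<open>ax_A1\<close> has one index range for both families, so pairs of
    coverings are enumerated. Every covering of either element still occurs, as the other factor is
    nonempty.\<close>
  define m where "m = card (covers x \<times> covers y)"
  have fin_prod: "finite (covers x \<times> covers y)"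
    using finite_covers[OF fin] by simp
  obtain p where p: "bij_betw p {1..m} (covers x \<times> covers y)"
    using ex_bij_betw_nat_finite_1[OF fin_prod] unfolding m_def by blast
  define s where "s j = fst (p j)" for j
  define t where "t j = snd (p j)" for j
  have st_cov: "s j \<in> covers x" "t j \<in> covers y" if "j \<in> {1..m}" for j
  proof -
    have "p j \<in> covers x \<times> covers y"
      using bij_betwE[OF p] that by blast
    then show "s j \<in> covers x" "t j \<in> covers y"
      by (auto simp: s_def t_def)
  qed
  have "m \<ge> 1"
    using fin_prod covers_nonempty[OF fin x] covers_nonempty[OF fin y]
    by (auto simp: m_def Suc_le_eq card_gt_0_iff simp del: card_cartesian_product)
  have "N \<ge> 1"
    using card_carrier_pos[OF fin] by (simp add: N_def)
  have carr: "\<forall>j\<in>{1..m}. \<forall>a\<in>{1..N}. s j a \<in> carrier S \<and> t j a \<in> carrier S"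
    and le: "\<forall>j\<in>{1..m}. x \<preceq> sum_upto (\<oplus>) (s j) N \<and> y \<preceq> sum_upto (\<oplus>) (t j) N"
    using st_cov by (fastforce simp: covers_def N_def)+
  obtain l k where lk: "\<forall>j\<in>{1..m}. l j \<in> {1..N} \<and> k j \<in> {1..N}"
    and le_C: "\<forall>u\<in>{1..m}. \<forall>j\<in>{1..u}. s j (l j) \<bowtie> s u (l u) \<and> t j (k j) \<bowtie> t u (k u)"
    and stC: "\<forall>j\<in>{1..m}. \<forall>u\<in>{1..m}. s j (l j) \<bowtie> t u (k u)"
    using ax_A1[of m N x y s t, OF \<open>m \<ge> 1\<close> \<open>N \<ge> 1\<close> x y carr xy le] by (elim exE conjE) (rule that)
  \<comment> \<open>The scheme gives contact within a family only for \<open>j \<le> u\<close>;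
    symmetry supplies the remaining pairs.\<close>
  have sC: "s j (l j) \<bowtie> s u (l u)" and tC: "t j (k j) \<bowtie> t u (k u)"
    if "j \<in> {1..m}" "u \<in> {1..m}" for j u
  proof -
    have "j \<in> {1..u} \<or> u \<in> {1..j}"
      using that by auto
    then have "s j (l j) \<bowtie> s u (l u) \<and> t j (k j) \<bowtie> t u (k u) \<or>
        s u (l u) \<bowtie> s j (l j) \<and> t u (k u) \<bowtie> t j (k j)"
      using that le_C by blast
    then show "s j (l j) \<bowtie> s u (l u)" "t j (k j) \<bowtie> t u (k u)"
      using that carr lk contact_sym by blast+
  qed
  define G where "G = (\<lambda>j. s j (l j)) ` {1..m}"
  define H where "H = (\<lambda>j. t j (k j)) ` {1..m}"
  have GC: "a \<bowtie> b" if "a \<in> G" "b \<in> G" for a b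
    using that sC unfolding G_def by blast
  have HC: "a \<bowtie> b" if "a \<in> H" "b \<in> H" for a b
    using that tC unfolding H_def by blast
  have GHC: "a \<bowtie> b" if "a \<in> G" "b \<in> H" for a b
    using that stC unfolding G_def H_def by blast
  \<comment> \<open>Members of \<open>G\<close> and of \<open>H\<close> are in contact with
    themselves, so zero is not among them and can play the part of \<open>u\<close> in
    \<open>ex_bound_of_complement\<close>.\<close>
  have zero: "\<zero> \<in> carrier S - G" "\<zero> \<in> carrier S - H"
    using GC HC contact_nonzero zero_closed by blast+
  have meets: "(\<exists>a\<in>{1..N}. f a \<in> G) \<and> (\<exists>a\<in>{1..N}. g a \<in> H)"
    if "f \<in> covers x" "g \<in> covers y" for f g
  proof -
    have "(f, g) \<in> p ` {1..m}"
      using p that by (simp add: bij_betw_def)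
    then obtain j where "j \<in> {1..m}" "s j = f" "t j = g"
      by (auto simp: s_def t_def) (metis fst_conv snd_conv)
    then show ?thesis
      using lk unfolding G_def H_def by blast
  qed
  have G_meets: "\<exists>a\<in>{1..N}. f a \<in> G" if "f \<in> covers x" for f
    using that meets covers_nonempty[OF fin y] by blast
  have H_meets: "\<exists>a\<in>{1..N}. g a \<in> H" if "g \<in> covers y" for g
    using that meets covers_nonempty[OF fin x] by blast
  obtain e where e: "e \<in> carrier S" "\<not> x \<preceq> e"
    and eG: "\<And>x. \<lbrakk>x \<in> carrier S; \<not> x \<preceq> e\<rbrakk> \<Longrightarrow> x \<in> G"
    using ex_bound_of_complement[OF fin zero(1), of x] G_meets unfolding N_def by blast
  obtain e' where e': "e' \<in> carrier S" "\<not> y \<preceq> e'"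
    and eH: "\<And>x. \<lbrakk>x \<in> carrier S; \<not> x \<preceq> e'\<rbrakk> \<Longrightarrow> x \<in> H"
    using ex_bound_of_complement[OF fin zero(2), of y] H_meets unfolding N_def by blast
  have "clans S e e" "clans S e' e'" "clans S e e'"
    by (simp_all add: clans_def eG eH GC HC GHC)
  then show thesis
    using that e e' by blast
qed

end

text \<open>The pairs \<open>(e, e)\<close> are the isolated points, and \<open>(e, e')\<close> lies in the closure of
  \<open>(e, e)\<close> and of \<open>(e', e')\<close>.\<close>

definition clan_points :: "'a struct \<Rightarrow> ('a \<times> 'a) set" where
  "clan_points S = {(e, e') \<in> carrier S \<times> carrier S. \<not> le S (one S) e \<and> \<not> le S (one S) e' \<and>
     clans S e e \<and> clans S e' e' \<and> clans S e e'}"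

lemma (in CJS) ex_topological_embedding:
  assumes fin: "finite (carrier S)" and inf: "infinite (UNIV :: 'p set)"
  obtains X :: "'p topology"
  where "finite (topspace X)" "\<And>\<phi>. top_contact_algebra X \<Turnstile> \<phi> \<Longrightarrow> S \<Turnstile> \<phi>"
proof -
  have fin_points: "finite (clan_points S)"
    by (rule finite_subset[of _ "carrier S \<times> carrier S"]) (use fin in \<open>auto simp: clan_points_def\<close>)
  obtain f :: "'a \<times> 'a \<Rightarrow> 'p" where f: "inj_on f (clan_points S)"
    using finite_inj_into_infinite[OF fin_points inf] by blast
  define P where "P = f ` clan_points S"
  define pt where "pt p = inv_into (clan_points S) f p" for p
  have pt: "pt (f q) = q" if "q \<in> clan_points S" for q
    using f that by (simp add: pt_def)
  have pt_closed: "fst (pt p) \<in> carrier S" "snd (pt p) \<in> carrier S" if "p \<in> P" for p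
    using that pt by (auto simp: P_def clan_points_def)
  \<comment> \<open>\<open>gen p q\<close> relates \<open>p\<close> to the isolated points
    \<open>q\<close> that every neighbourhood of \<open>p\<close> must contain; the open sets are
    the sets of points closed under this relation.\<close>
  define gen where "gen p q \<longleftrightarrow> fst (pt q) = snd (pt q) \<and> fst (pt q) \<in> {fst (pt p), snd (pt p)}"
    for p q
  define X where "X = topology (\<lambda>U. U \<subseteq> P \<and> (\<forall>p\<in>U. \<forall>q\<in>P. gen p q \<longrightarrow> q \<in> U))"
  have "istopology (\<lambda>U. U \<subseteq> P \<and> (\<forall>p\<in>U. \<forall>q\<in>P. gen p q \<longrightarrow> q \<in> U))"
    unfolding istopology_def by blast
  then have openX: "openin X U \<longleftrightarrow> U \<subseteq> P \<and> (\<forall>p\<in>U. \<forall>q\<in>P. gen p q \<longrightarrow> q \<in> U)" for U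
    unfolding X_def by (simp add: topology_inverse')
  have topX: "topspace X = P"
    using openX[of P] openX[of "topspace X"] openin_subset[of X P] by auto
  \<comment> \<open>A Stone-type map: \<open>x\<close> goes to the points with a component whose
    prime up-set contains \<open>x\<close>.\<close>
  define h where "h x = {p \<in> P. \<not> x \<preceq> fst (pt p) \<or> \<not> x \<preceq> snd (pt p)}" for x
  have h_pt: "f (e, e') \<in> h x \<longleftrightarrow> \<not> x \<preceq> e \<or> \<not> x \<preceq> e'" if "(e, e') \<in> clan_points S" for x e e'
    using that pt by (simp add: h_def P_def)
  have closed_h: "closedin X (h x)" for x
    unfolding closedin_def topX openX h_def gen_def by auto
  have reg: "h x \<in> regular_closed X" for x
  proof -
    \<comment> \<open>The isolated points of \<open>h x\<close> form an open subset, and the closure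
      of this subset is shown to contain all of \<open>h x\<close>.\<close>
    define U where "U = {p \<in> h x. fst (pt p) = snd (pt p)}"
    have "openin X U"
      unfolding openX U_def h_def gen_def by auto
    then have "U \<subseteq> X interior_of (h x)"
      by (rule interior_of_maximal[rotated]) (auto simp: U_def)
    moreover have "h x \<subseteq> X closure_of U"
    proof
      fix p assume p: "p \<in> h x"
      then obtain e e' where ee: "(e, e') \<in> clan_points S" "p = f (e, e')"
        by (auto simp: h_def P_def)
      \<comment> \<open>\<open>c\<close> is a component whose up-set contains \<open>x\<close>. The
        isolated point of \<open>c\<close> then lies in \<open>h x\<close> and in every
        neighbourhood of \<open>p\<close>.\<close>
      define c where "c = (if \<not> x \<preceq> e then e else e')"
      have cc: "(c, c) \<in> clan_points S"
        using ee(1) by (auto simp: c_def clan_points_def)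
      have "\<not> x \<preceq> c"
        using p ee h_pt by (auto simp: c_def)
      then have "f (c, c) \<in> U" "gen p (f (c, c))"
        using cc ee pt h_pt by (auto simp: U_def gen_def c_def)
      moreover have "f (c, c) \<in> P"
        using cc by (simp add: P_def)
      moreover have "p \<in> P"
        using ee by (simp add: P_def)
      ultimately show "p \<in> X closure_of U"
        unfolding in_closure_of topX openX by blast
    qed
    ultimately have "h x \<subseteq> X closure_of (X interior_of (h x))"
      using closure_of_mono by blast
    moreover have "X closure_of (X interior_of (h x)) \<subseteq> h x"
      using closed_h by (simp add: closure_of_minimal interior_of_subset)
    moreover have "h x \<subseteq> topspace X"
      by (auto simp: topX h_def)
    ultimately show ?thesis
      by (simp add: regular_closed_def subset_antisym)
  qed
  have le: "h x \<subseteq> h y \<longleftrightarrow> x \<preceq> y" if x: "x \<in> carrier S" and y: "y \<in> carrier S" for x y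
  proof
    assume sub: "h x \<subseteq> h y"
    show "x \<preceq> y"
    proof (rule ccontr)
      assume "\<not> x \<preceq> y"
      then obtain e where e: "e \<in> carrier S" "y \<preceq> e" "\<not> x \<preceq> e" "clans S e e"
        using separation[OF fin x y] by blast
      moreover have "\<not> \<one> \<preceq> e"
        using e x le_one one_closed le_trans by blast
      ultimately have "(e, e) \<in> clan_points S"
        by (simp add: clan_points_def)
      then show False
        using e sub h_pt by blast
    qed
  next
    assume "x \<preceq> y"
    then have "x \<preceq> e" if "y \<preceq> e" "e \<in> carrier S" for e
      using le_trans[OF x y] that by blast
    then show "h x \<subseteq> h y"
      using pt_closed unfolding h_def by blast
  qed
  have contact: "h x \<inter> h y \<noteq> {} \<longleftrightarrow> x \<bowtie> y" if x: "x \<in> carrier S" and y: "y \<in> carrier S" for x y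
  proof
    assume "h x \<inter> h y \<noteq> {}"
    then obtain p where "p \<in> h x" "p \<in> h y" "p \<in> P"
      by (auto simp: h_def)
    then obtain e e' where "(e, e') \<in> clan_points S" "\<not> x \<preceq> e \<or> \<not> x \<preceq> e'" "\<not> y \<preceq> e \<or> \<not> y \<preceq> e'"
      using h_pt by (auto simp: P_def)
    \<comment> \<open>\<open>clans S e e'\<close> relates the components in this order only, so one
      of the mixed cases yields contact of \<open>y\<close> with \<open>x\<close>.\<close>
    then have "x \<bowtie> y \<or> y \<bowtie> x"
      using x y unfolding clan_points_def clans_def by blast
    then show "x \<bowtie> y"
      using x y contact_sym by blast
  next
    assume "x \<bowtie> y"
    then obtain e e' where e: "e \<in> carrier S" "e' \<in> carrier S" "\<not> x \<preceq> e" "\<not> y \<preceq> e'"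
      "clans S e e" "clans S e' e'" "clans S e e'"
      using contact_witness[OF fin x y] by blast
    moreover have "\<not> \<one> \<preceq> e" "\<not> \<one> \<preceq> e'"
      using e x y le_one one_closed le_trans by blast+
    ultimately have "(e, e') \<in> clan_points S"
      by (simp add: clan_points_def)
    then show "h x \<inter> h y \<noteq> {}"
      using e h_pt by blast
  qed
  \<comment> \<open>A point has no component above \<open>\<one>\<close>, by the definition of
    \<open>clan_points\<close>; hence every point lies in \<open>h \<one>\<close>.\<close>
  have zero: "h \<zero> = {}" and one: "h \<one> = P"
    using zero_le by (auto simp: h_def P_def pt clan_points_def)
  have plus: "h (x \<oplus> y) = h x \<union> h y" if x: "x \<in> carrier S" and y: "y \<in> carrier S" for x y
  proof -
    have "x \<oplus> y \<preceq> e \<longleftrightarrow> x \<preceq> e \<and> y \<preceq> e" if "e \<in> carrier S" for e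
      using that x y plus_least le_plus plus_comm plus_closed le_trans by metis
    then show ?thesis
      using pt_closed by (auto simp: h_def)
  qed
  have "inj_on h (carrier S)"
    using le le_antisym by (metis inj_onI subset_refl)
  then have "S \<Turnstile> \<phi>" if "top_contact_algebra X \<Turnstile> \<phi>" for \<phi>
    by (intro true_in_embedding[OF L_structure_axioms that, of h])
      (auto simp: top_contact_algebra_def reg le contact zero one plus topX)
  moreover have "finite (topspace X)"
    using fin_points by (simp add: topX P_def)
  ultimately show thesis
    using that by blast
qed

text \<open>A topological contact algebra lives on a type of sets; relabelling its elements moves a
  counterexample to the prescribed type \<open>'d\<close>.\<close>

lemma (in DCJS) transport:
  fixes f :: "'a \<Rightarrow> 'd"
  assumes f: "inj_on f (carrier S)"
  obtains T :: "'d struct" where "DCJS T" "\<And>\<phi>. T \<Turnstile> \<phi> \<Longrightarrow> S \<Turnstile> \<phi>"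
proof -
  define g where "g = inv_into (carrier S) f"
  have g: "g (f x) = x" if "x \<in> carrier S" for x
    using f that by (simp add: g_def)
  define T where "T = \<lparr>carrier = f ` carrier S, le = (\<lambda>a b. g a \<preceq> g b), zero = f \<zero>, one = f \<one>,
    plus = (\<lambda>a b. f (g a \<oplus> g b)), contact = (\<lambda>a b. g a \<bowtie> g b)\<rparr>"
  have T: "carrier T = f ` carrier S" "zero T = f \<zero>" "one T = f \<one>"
    and le: "le T (f x) (f y) \<longleftrightarrow> x \<preceq> y" and contact: "contact T (f x) (f y) \<longleftrightarrow> x \<bowtie> y"
    and plus: "plus T (f x) (f y) = f (x \<oplus> y)"
    if "x \<in> carrier S" "y \<in> carrier S" for x y
    using that by (simp_all add: T_def g)
  note T = T[OF zero_closed zero_closed]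
  have "DCJS T"
  proof unfold_locales
    show "zero T \<in> carrier T" "one T \<in> carrier T"
      by (simp_all add: T zero_closed one_closed)
    fix x assume "x \<in> carrier T"
    then obtain a where a: "a \<in> carrier S" "x = f a"
      by (auto simp: T)
    show "le T x x" "le T (zero T) x" "le T x (one T)"
      using a by (simp_all add: T le zero_closed one_closed le_refl zero_le le_one)
    show "contact T x x" if "x \<noteq> zero T"
      using that a contact_refl[of a] by (auto simp: T contact)
    fix y assume "y \<in> carrier T"
    then obtain b where b: "b \<in> carrier S" "y = f b"
      by (auto simp: T)
    show "plus T x y \<in> carrier T" "plus T x y = plus T y x" "le T x (plus T x y)"
      using a b plus_comm[of a b] le_plus[of a b] by (simp_all add: T plus le plus_closed)
    show "x = y" if "le T x y" "le T y x"
      using that a b le_antisym[of a b] by (simp add: le)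
    show "x \<noteq> zero T" if "contact T x y"
      using that a b contact_nonzero[of a b] zero_closed by (simp add: T contact inj_on_eq_iff[OF f])
    show "contact T y x" if "contact T x y"
      using that a b contact_sym[of a b] by (simp add: contact)
    fix z assume "z \<in> carrier T"
    then obtain c where c: "c \<in> carrier S" "z = f c"
      by (auto simp: T)
    show "le T x z" if "le T x y" "le T y z"
      using that a b c le_trans[of a b c] by (simp add: le)
    show "le T (plus T x y) z" if "le T x z" "le T y z"
      using that a b c plus_least[of a b c] by (simp add: le plus plus_closed)
    show "contact T x y \<or> contact T x z" if "contact T x (plus T y z)"
      using that a b c contact_plus[of a b c] by (simp add: contact plus plus_closed)
    show "contact T x z" if "contact T x y" "le T y z"
      using that a b c contact_mono[of a b c] by (simp add: contact le)
    show "\<exists>y'\<in>carrier T. \<exists>z'\<in>carrier T. le T y' y \<and> le T z' z \<and> x = plus T y' z'"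
      if "le T x (plus T y z)"
    proof -
      have "a \<preceq> b \<oplus> c"
        using that a b c by (simp add: le plus plus_closed)
      then obtain b' c' where "b' \<in> carrier S" "c' \<in> carrier S" "b' \<preceq> b" "c' \<preceq> c" "a = b' \<oplus> c'"
        using distrib a(1) b(1) c(1) by blast
      then show ?thesis
        using a b c by (intro bexI[of _ "f b'"] bexI[of _ "f c'"]) (simp_all add: T le plus)
    qed
  qed
  moreover have "S \<Turnstile> \<phi>" if "T \<Turnstile> \<phi>" for \<phi>
    by (rule true_in_embedding[OF L_structure_axioms that, of f])
      (simp_all add: T le plus contact f)
  ultimately show thesis
    using that by blast
qed

text \<open>Each semantic condition is compared with derivability. Fixing an arbitrary infinite type
  in each of them leaves enough room, because the countermodels constructed have finite carriers or
  finite underlying spaces.\<close>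

theorem mainTheorem5:
  fixes \<phi> :: fm and n :: nat
  assumes "n = card (vars \<phi>)"
    and "infinite (UNIV :: 'p set)" "infinite (UNIV :: 'd set)"
      "infinite (UNIV :: 'c set)" "infinite (UNIV :: 'f set)"
  shows "((\<turnstile> \<phi>) \<longleftrightarrow> (\<forall>X :: 'p topology. top_contact_algebra X \<Turnstile> \<phi>)) \<and>
         ((\<turnstile> \<phi>) \<longleftrightarrow> (\<forall>S :: 'd struct. DCJS S \<longrightarrow> S \<Turnstile> \<phi>)) \<and>
         ((\<turnstile> \<phi>) \<longleftrightarrow> (\<forall>S :: 'c struct. CJS S \<longrightarrow> S \<Turnstile> \<phi>)) \<and>
         ((\<turnstile> \<phi>) \<longleftrightarrow> (\<forall>S :: 'f struct. CJS S \<and> finite (carrier S) \<and> card (carrier S) \<le> 2 ^ n + 1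
                       \<longrightarrow> S \<Turnstile> \<phi>))"
proof (intro conjI iffI allI impI)
  show "top_contact_algebra X \<Turnstile> \<phi>" if "\<turnstile> \<phi>" for X :: "'p topology"
    using that CJS.sound DCJS.CJS DCJS_top_contact_algebra by blast
  show "S \<Turnstile> \<phi>" if "\<turnstile> \<phi>" "DCJS S" for S :: "'d struct"
    using that CJS.sound DCJS.CJS by blast
  show "S \<Turnstile> \<phi>" if "\<turnstile> \<phi>" "CJS S" for S :: "'c struct"
    using that CJS.sound by blast
  show "S \<Turnstile> \<phi>" if "\<turnstile> \<phi>" "CJS S \<and> finite (carrier S) \<and> card (carrier S) \<le> 2 ^ n + 1"
    for S :: "'f struct"
    using that CJS.sound by blast
  show "\<turnstile> \<phi>" if true: "\<forall>X :: 'p topology. top_contact_algebra X \<Turnstile> \<phi>"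
  proof (rule ccontr)
    assume "\<not> \<turnstile> \<phi>"
    then obtain S :: "nat struct" where S: "CJS S" "finite (carrier S)" "\<not> S \<Turnstile> \<phi>"
      using finite_countermodel infinite_UNIV_nat by blast
    then show False
      using CJS.ex_topological_embedding[OF S(1,2) assms(2)] true by blast
  qed
  show "\<turnstile> \<phi>" if true: "\<forall>S :: 'd struct. DCJS S \<longrightarrow> S \<Turnstile> \<phi>"
  proof (rule ccontr)
    assume "\<not> \<turnstile> \<phi>"
    then obtain S :: "nat struct" where S: "CJS S" "finite (carrier S)" "\<not> S \<Turnstile> \<phi>"
      using finite_countermodel infinite_UNIV_nat by blast
    then obtain X :: "nat topology" where X: "finite (topspace X)" "\<not> top_contact_algebra X \<Turnstile> \<phi>"
      using CJS.ex_topological_embedding[OF S(1,2) infinite_UNIV_nat] by metis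
    \<comment> \<open>A finite space has finitely many subsets, so its algebra can be injected into
      any infinite type.\<close>
    have "finite (carrier (top_contact_algebra X))"
      by (rule finite_subset[of _ "Pow (topspace X)"])
        (use X in \<open>auto simp: top_contact_algebra_def regular_closed_def\<close>)
    then obtain f :: "nat set \<Rightarrow> 'd" where f: "inj_on f (carrier (top_contact_algebra X))"
      using finite_inj_into_infinite assms(3) by blast
    obtain T :: "'d struct" where "DCJS T" "\<not> T \<Turnstile> \<phi>"
      using DCJS.transport[OF DCJS_top_contact_algebra f] X(2) by metis
    then show False
      using true by blast
  qed
  show "\<turnstile> \<phi>" if "\<forall>S :: 'c struct. CJS S \<longrightarrow> S \<Turnstile> \<phi>"
    using that finite_countermodel assms(4) by blast
  show "\<turnstile> \<phi>" if "\<forall>S :: 'f struct. CJS S \<and> finite (carrier S) \<and> card (carrier S) \<le> 2 ^ n + 1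
      \<longrightarrow> S \<Turnstile> \<phi>"
    using that finite_countermodel assms(1,5) by metis
qed

end
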